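(* Let $n\geq 1$, $\nu\geq 1$. Let $w\in F_n$ be a positive word of length $k$ that is not a proper power, and let $\mathcal{Q}$ be the multiset of the integers $q$ ($0\leq q<n$), one for each length-two cyclic subword $x_ix_{i+q}$ of $w$ (subscripts mod $n$). Suppose that the cyclic presentation $P_n(w)$ is irreducible and non-redundant and let $\Gamma$ be the star graph of $P_n(w)$. Then $P_n(w)$ is $(2,k,\nu)$-special if and only if either (a) $k\geq 5$ is odd, $n=k$, $\nu=1$, $\mathcal{Q}=\{0,1,2,\ldots,n-1\}$, in which case $\Gamma$ is the complete bipartite graph $K_{n,n}$; or (b) $k\geq 4$ is even, $n=2k$, $\nu=2$, $\mathcal{Q}=\{1,3,\ldots,n-1\}$, in which case $\Gamma$ is the disjoint union of two copies of $K_{n/2,n/2}$. (The equalities for $\mathcal{Q}$ are equalities of multisets.)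
   Context: Cyclic presentations: $F_n$ is the free group with basis $x_0,\ldots,x_{n-1}$ and $\theta:F_n\to F_n$ is the automorphism $\theta(x_i)=x_{i+1}$ (subscripts mod $n$). For a cyclically reduced word $w\in F_n$, $P_n(w)=\langle x_0,\ldots,x_{n-1}\mid w,\theta(w),\ldots,\theta^{n-1}(w)\rangle$. Throughout it is assumed that $x_0$ is a letter of $w$. $P_n(w)$ is irreducible if the greatest common divisor of $n$ and the subscripts of the generators appearing in $w$ is $1$. A word is positive if all exponents of its generators are positive. The word $w$ is a proper power if $w=v^t$ for some $v$ and some $t\geq 2$. Non-redundant: a relator $r\in R$ of $\langle X\mid R\rangle$ is freely redundant if it is freely trivial or there is $s\in R$ such that $r,s$ are distinct elements of the free group on $X$ and $r$ is freely conjugate to $s$ or to $s^{-1}$. A presentation is non-redundant if it contains no freely redundant relator. Star graph: let $\tilde R$ be the set of all cyclic permutations of elements of $R\cup R^{-1}$. The star graph of $\langle X\mid R\rangle$ (all relators cyclically reduced) is the undirected graph, possibly with multiple edges, with vertex set $X\cup X^{-1}$ and an edge joining $x$ and $y$ for each distinct word of the form $xy^{-1}u$ in $\tilde R$, where the edges corresponding to the inverse pair $xy^{-1}u$, $yx^{-1}u^{-1}$ are identified. Special presentations: let $m\geq 2$, $k\geq 3$, $\nu\geq 1$. A finite presentation $\langle X\mid R\rangle$ is $(m,k,\nu)$-special if (a) its star graph has exactly $\nu$ connected components, which are pairwise isomorphic, each a connected bipartite graph of diameter $m$ and girth $2m$ in which each vertex has degree at least $3$; (b) each relator has length $k$; (c)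 if $m=2$ then $k\geq 4$. Girth is the length of a shortest closed path in which consecutive edges are never equal (so a pair of parallel edges gives such a path of length $2$). *)

theory Defs
  imports "HOL-Library.Extended_Nat" "HOL-Library.Multiset"
begin

section \<open>Words and free groups\<close>

text \<open>The letter \<open>(x, True)\<close> stands for \<open>x\<close> and \<open>(x, False)\<close> for its formal inverse.
  Elements of a free group are represented by arbitrary words; equality in the free group is
  the equivalence \<open>free_eq\<close> generated by cancelling adjacent inverse letters.\<close>

type_synonym 'a letter = "'a \<times> bool"
type_synonym 'a word = "'a letter list"

definition inv_letter :: "'a letter \<Rightarrow> 'a letter" where
  "inv_letter l = (fst l, \<not> snd l)"

definition inv_word :: "'a word \<Rightarrow> 'a word" where
  "inv_word w = rev (map inv_letter w)"

definition words :: "'a set \<Rightarrow> 'a word set" where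
  "words X = lists (X \<times> UNIV)"

inductive cancels :: "'a word \<Rightarrow> 'a word \<Rightarrow> bool" where
  "cancels (u @ [l, inv_letter l] @ v) (u @ v)"

definition free_eq :: "'a word \<Rightarrow> 'a word \<Rightarrow> bool" where
  "free_eq = equivclp cancels"

definition freely_reduced :: "'a word \<Rightarrow> bool" where
  "freely_reduced w \<longleftrightarrow> successively (\<lambda>a b. b \<noteq> inv_letter a) w"

definition cyclically_reduced :: "'a word \<Rightarrow> bool" where
  "cyclically_reduced w \<longleftrightarrow> (\<forall>i. freely_reduced (rotate i w))"

definition freely_conjugate :: "'a set \<Rightarrow> 'a word \<Rightarrow> 'a word \<Rightarrow> bool" where
  "freely_conjugate X r s \<longleftrightarrow> (\<exists>g\<in>words X. free_eq r (g @ s @ inv_word g))"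

definition proper_power :: "'a set \<Rightarrow> 'a word \<Rightarrow> bool" where
  "proper_power X w \<longleftrightarrow> (\<exists>v\<in>words X. \<exists>t\<ge>2. free_eq w (concat (replicate t v)))"

definition positive :: "'a word \<Rightarrow> bool" where
  "positive w \<longleftrightarrow> (\<forall>l\<in>set w. snd l)"


section \<open>Presentations\<close>

record 'a presentation =
  gens :: "'a set"
  rels :: "'a word set"

definition freely_redundant :: "'a presentation \<Rightarrow> 'a word \<Rightarrow> bool" where
  "freely_redundant P r \<longleftrightarrow>
     free_eq r [] \<or>
     (\<exists>s\<in>rels P. \<not> free_eq r s \<and>
        (freely_conjugate (gens P) r s \<or> freely_conjugate (gens P) r (inv_word s)))"

definition non_redundant :: "'a presentation \<Rightarrow> bool" where
  "non_redundant P \<longleftrightarrow> (\<forall>r\<in>rels P. \<not> freely_redundant P r)"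


section \<open>Undirected graphs with loops and multiple edges\<close>

text \<open>\<open>ends G e\<close> is the set of end points of the edge \<open>e\<close>: two vertices, or one if \<open>e\<close> is a loop.\<close>

record ('v, 'e) multigraph =
  verts :: "'v set"
  edges :: "'e set"
  ends :: "'e \<Rightarrow> 'v set"

fun walk :: "('v, 'e) multigraph \<Rightarrow> 'v \<Rightarrow> 'e list \<Rightarrow> 'v \<Rightarrow> bool" where
  "walk G u [] v \<longleftrightarrow> u \<in> verts G \<and> u = v"
| "walk G u (e # es) v \<longleftrightarrow>
     u \<in> verts G \<and> e \<in> edges G \<and> (\<exists>x. ends G e = {u, x} \<and> walk G x es v)"

definition reachable :: "('v, 'e) multigraph \<Rightarrow> 'v \<Rightarrow> 'v \<Rightarrow> bool" where
  "reachable G u v \<longleftrightarrow> (\<exists>es. walk G u es v)"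

definition connected_graph :: "('v, 'e) multigraph \<Rightarrow> bool" where
  "connected_graph G \<longleftrightarrow> verts G \<noteq> {} \<and> (\<forall>u\<in>verts G. \<forall>v\<in>verts G. reachable G u v)"

definition induced_subgraph :: "('v, 'e) multigraph \<Rightarrow> 'v set \<Rightarrow> ('v, 'e) multigraph" where
  "induced_subgraph G C =
     \<lparr>verts = C, edges = {e \<in> edges G. ends G e \<subseteq> C}, ends = ends G\<rparr>"

definition components :: "('v, 'e) multigraph \<Rightarrow> ('v, 'e) multigraph set" where
  "components G = (\<lambda>v. induced_subgraph G {u. reachable G v u}) ` verts G"

definition bipartite :: "('v, 'e) multigraph \<Rightarrow> bool" where
  "bipartite G \<longleftrightarrow>
     (\<exists>A B. verts G = A \<union> B \<and> A \<inter> B = {} \<and>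
        (\<forall>e\<in>edges G. \<exists>a\<in>A. \<exists>b\<in>B. ends G e = {a, b}))"

definition distance :: "('v, 'e) multigraph \<Rightarrow> 'v \<Rightarrow> 'v \<Rightarrow> enat" where
  "distance G u v = Inf {enat (length es) | es. walk G u es v}"

definition diameter :: "('v, 'e) multigraph \<Rightarrow> enat" where
  "diameter G = (SUP u\<in>verts G. SUP v\<in>verts G. distance G u v)"

text \<open>Only the consecutive edges of the edge sequence are required to differ; a closed path of
  length at least two whose last and first edges agree can be shortened at both ends, so it never
  attains the infimum. A loop is a closed path of length one. The girth is \<open>\<infinity>\<close> if there is no such closed path.\<close>

definition girth :: "('v, 'e) multigraph \<Rightarrow> enat" where
  "girth G = Inf {enat (length es) | u es. es \<noteq> [] \<and> walk G u es u \<and> distinct_adj es}"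

text \<open>Loops count twice.\<close>

definition degree :: "('v, 'e) multigraph \<Rightarrow> 'v \<Rightarrow> nat" where
  "degree G v = card {e \<in> edges G. v \<in> ends G e} + card {e \<in> edges G. ends G e = {v}}"

definition graph_iso :: "('v, 'e) multigraph \<Rightarrow> ('w, 'f) multigraph \<Rightarrow> bool" where
  "graph_iso G H \<longleftrightarrow>
     (\<exists>f g. bij_betw f (verts G) (verts H) \<and> bij_betw g (edges G) (edges H) \<and>
        (\<forall>e\<in>edges G. ends H (g e) = f ` ends G e))"

definition complete_bipartite :: "nat \<Rightarrow> nat \<Rightarrow> (nat + nat, nat \<times> nat) multigraph" where
  "complete_bipartite a b =
     \<lparr>verts = {..<a} <+> {..<b}, edges = {..<a} \<times> {..<b}, ends = (\<lambda>(i, j). {Inl i, Inr j})\<rparr>"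

definition disjoint_union ::
  "('v, 'e) multigraph \<Rightarrow> ('w, 'f) multigraph \<Rightarrow> ('v + 'w, 'e + 'f) multigraph" where
  "disjoint_union G H =
     \<lparr>verts = verts G <+> verts H, edges = edges G <+> edges H,
      ends = case_sum (\<lambda>e. Inl ` ends G e) (\<lambda>e. Inr ` ends H e)\<rparr>"


section \<open>Star graphs and special presentations\<close>

definition sym_closure :: "'a presentation \<Rightarrow> 'a word set" where
  "sym_closure P = {rotate i r | i r. r \<in> rels P \<union> inv_word ` rels P}"

text \<open>Here \<open>x\<close>, \<open>y\<close> range over letters. An edge is an inverse pair of words
  \<open>x y\<^sup>-\<^sup>1 u\<close>, \<open>y x\<^sup>-\<^sup>1 u\<^sup>-\<^sup>1\<close>; its end points \<open>x\<close>, \<open>y\<close> are the first letters of these two words.\<close>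

definition star_graph :: "'a presentation \<Rightarrow> ('a letter, 'a word set) multigraph" where
  "star_graph P =
     \<lparr>verts = gens P \<times> UNIV,
      edges = {{x # inv_letter y # u, y # inv_letter x # inv_word u} | x y u.
                 x # inv_letter y # u \<in> sym_closure P},
      ends = (\<lambda>e. hd ` e)\<rparr>"

definition special :: "nat \<Rightarrow> nat \<Rightarrow> nat \<Rightarrow> 'a presentation \<Rightarrow> bool" where
  "special m k \<nu> P \<longleftrightarrow>
     m \<ge> 2 \<and> k \<ge> 3 \<and> \<nu> \<ge> 1 \<and>
     finite (gens P) \<and> finite (rels P) \<and> rels P \<subseteq> words (gens P) \<and>
     (\<forall>r\<in>rels P. cyclically_reduced r) \<and>
     card (components (star_graph P)) = \<nu> \<and>
     (\<forall>C\<in>components (star_graph P). \<forall>D\<in>components (star_graph P). graph_iso C D) \<and>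
     (\<forall>C\<in>components (star_graph P).
        connected_graph C \<and> bipartite C \<and> diameter C = enat m \<and> girth C = enat (2 * m) \<and>
        (\<forall>v\<in>verts C. degree C v \<ge> 3)) \<and>
     (\<forall>r\<in>rels P. length r = k) \<and>
     (m = 2 \<longrightarrow> k \<ge> 4)"


section \<open>Cyclic presentations\<close>

text \<open>The generator \<open>x\<^sub>i\<close> of the free group of rank \<open>n\<close> is the natural number \<open>i < n\<close>.\<close>

definition shift :: "nat \<Rightarrow> nat word \<Rightarrow> nat word" where
  "shift n = map (\<lambda>(i, e). ((i + 1) mod n, e))"

definition cyclic_presentation :: "nat \<Rightarrow> nat word \<Rightarrow> nat presentation" where
  "cyclic_presentation n w = \<lparr>gens = {..<n}, rels = (\<lambda>j. (shift n ^^ j) w) ` {..<n}\<rparr>"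

definition subscripts :: "nat word \<Rightarrow> nat set" where
  "subscripts w = fst ` set w"

definition irreducible_cyclic :: "nat \<Rightarrow> nat word \<Rightarrow> bool" where
  "irreducible_cyclic n w \<longleftrightarrow> Gcd (insert n (subscripts w)) = 1"

text \<open>For positive \<open>w\<close>: one entry, in \<open>{0..<n}\<close>, for each of the \<open>length w\<close> positions at which a
  cyclic subword of length two starts.\<close>

definition step_multiset :: "nat \<Rightarrow> nat word \<Rightarrow> nat multiset" where
  "step_multiset n w =
     image_mset
       (\<lambda>j. nat ((int (fst (w ! (Suc j mod length w))) - int (fst (w ! j))) mod int n))
       (mset_set {..<length w})"

end

theory Submission
  imports Defs
begin

text \<open>Write \<open>w = x\<^bsub>a(0)\<^esub> \<dots> x\<^bsub>a(k-1)\<^esub>\<close> and \<open>q\<^sub>i = a(i+1) - a(i)\<close> modulo \<open>n\<close>. As \<open>w\<close> is not a proper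
  power and the presentation is non-redundant, the \<open>n k\<close> rotations of relators are distinct, so the star
  graph has one edge from \<open>x\<^sub>c\<close> to the inverse of \<open>x\<^bsub>c+q(i)\<^esub>\<close> for each \<open>c\<close> modulo \<open>n\<close> and each \<open>i < k\<close>.

  A bipartite graph of diameter 2 and girth 4 is a simple complete bipartite graph. Walking along three
  edges from \<open>x\<^sub>0\<close>, one sees that the set \<open>S\<close> of the \<open>q\<^sub>i\<close>, which are distinct, is closed under
  \<open>a - b + c\<close>. Hence \<open>n = d k\<close> and \<open>S = r + d \<int> / n \<int>\<close>, with \<open>0 \<le> r < d\<close>. The steps of a cyclic word add up
  to \<open>0\<close> modulo \<open>n\<close>, so that \<open>d\<close> divides \<open>2 r\<close>; irreducibility gives \<open>gcd d r = 1\<close>. So \<open>d \<le> 2\<close>, and the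
  parity of \<open>k\<close> decides between \<open>d = 1\<close> and \<open>d = 2\<close>. In both cases \<open>S\<close> is the class of \<open>-1\<close> modulo \<open>d\<close>,
  and the star graph is a disjoint union of \<open>d\<close> copies of the complete bipartite graph on \<open>k + k\<close>
  vertices, whence \<open>\<nu> = d\<close>.\<close>

section \<open>Positive words\<close>

lemma inv_letter_inv_letter [simp]: "inv_letter (inv_letter l) = l"
  by (simp add: inv_letter_def)

lemma inv_word_Nil [simp]: "inv_word [] = []"
  and inv_word_Cons [simp]: "inv_word (l # w) = inv_word w @ [inv_letter l]"
  and inv_word_append [simp]: "inv_word (u @ v) = inv_word v @ inv_word u"
  and length_inv_word [simp]: "length (inv_word w) = length w"
  by (simp_all add: inv_word_def)

lemma inv_word_inv_word [simp]: "inv_word (inv_word w) = w"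
  by (simp add: inv_word_def rev_map [symmetric] o_def)

lemma inv_word_rotate: "\<exists>i. inv_word (rotate m r) = rotate i (inv_word r)"
  unfolding inv_word_def by (metis rotate_map rotate_rev rev_rev_ident)

text \<open>Left multiplication of a reduced word by one letter. Folding it over a word computes the
  normal form, which separates classes of \<open>free_eq\<close> without a confluence
  argument.\<close>

fun push :: "'a letter \<Rightarrow> 'a word \<Rightarrow> 'a word" where
  "push l [] = [l]"
| "push l (m # w) = (if m = inv_letter l then w else l # m # w)"

lemma freely_reduced_Nil [simp]: "freely_reduced []"
  by (simp add: freely_reduced_def)

lemma freely_reduced_Cons:
  "freely_reduced (l # w) \<longleftrightarrow> freely_reduced w \<and> (w = [] \<or> hd w \<noteq> inv_letter l)"
  by (cases w) (auto simp: freely_reduced_def)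

lemma freely_reduced_push: "freely_reduced w \<Longrightarrow> freely_reduced (push l w)"
  by (cases w) (auto simp: freely_reduced_Cons)

text \<open>If \<open>w\<close> starts with \<open>l\<close>, the inner push removes that letter,
  and reducedness ensures that the outer push puts it back instead of cancelling further.\<close>

lemma push_push_inv: "freely_reduced w \<Longrightarrow> push l (push (inv_letter l) w) = w"
  by (cases w rule: list.exhaust[case_product list.exhaust[of "tl w"]])
     (auto simp: freely_reduced_Cons)

lemma freely_reduced_foldr_push: "freely_reduced (foldr push w [])"
  by (induction w) (auto simp: freely_reduced_push)

text \<open>A cancelled pair acts as the identity on the reduced word folded from its right-hand
  context, so the fold is an invariant of free equality.\<close>

lemma foldr_push_free_eq:
  assumes "free_eq u v"
  shows "foldr push u [] = foldr push v []"
  using assms unfolding free_eq_def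
proof (induction rule: equivclp_induct)
  case (step y z)
  have "foldr push y [] = foldr push z []" if "cancels y z" for y z :: "'a word"
    using that by cases (simp add: push_push_inv freely_reduced_foldr_push)
  with step show ?case by auto
qed simp

lemma foldr_push_positive: "positive w \<Longrightarrow> foldr push w [] = w"
proof (induction w)
  case (Cons l w)
  then show ?case
    by (cases w) (auto simp: positive_def inv_letter_def)
qed simp

text \<open>Nothing cancels in a positive word, so it is its own normal form. Between positive
  relators, distinctness in the free group is therefore distinctness of lists.\<close>

lemma free_eq_positive:
  assumes "positive u" "positive v" "free_eq u v"
  shows "u = v"
  using foldr_push_free_eq[OF assms(3)] assms(1,2) by (simp add: foldr_push_positive)

lemma cyclically_reduced_positive: "positive w \<Longrightarrow> cyclically_reduced w"
proof -
  have "freely_reduced w" if "positive w" for w :: "'a word"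
    using that
  proof (induction w)
    case (Cons l w)
    then show ?case
      by (cases w) (auto simp: freely_reduced_Cons positive_def inv_letter_def)
  qed simp
  then show "positive w \<Longrightarrow> cyclically_reduced w"
    by (simp add: cyclically_reduced_def positive_def)
qed

lemma free_eq_append_inv_word: "free_eq (u @ g @ inv_word g) u"
proof (induction g rule: rev_induct)
  case (snoc l g)
  have "cancels ((u @ g) @ [l, inv_letter l] @ inv_word g) ((u @ g) @ inv_word g)"
    by (rule cancels.intros)
  then have "free_eq (u @ (g @ [l]) @ inv_word (g @ [l])) (u @ g @ inv_word g)"
    by (auto simp: free_eq_def)
  with snoc show ?case
    unfolding free_eq_def by (metis equivclp_trans)
qed (simp add: free_eq_def)

text \<open>Writing \<open>r = g @ h\<close>, the conjugate of \<open>h @ g\<close> by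
  \<open>g\<close> is \<open>r @ g @ inv_word g\<close>, whose tail cancels.\<close>

lemma freely_conjugate_rotate:
  assumes "r \<in> words X"
  shows "freely_conjugate X r (rotate i r)"
proof -
  define g where "g = take (i mod length r) r"
  have "rotate i r = drop (i mod length r) r @ g"
    by (simp add: rotate_drop_take g_def)
  then have "g @ rotate i r @ inv_word g = r @ g @ inv_word g"
    by (simp add: g_def flip: append_assoc)
  then have "free_eq r (g @ rotate i r @ inv_word g)"
    using free_eq_append_inv_word[of r g] unfolding free_eq_def by (metis equivclp_sym)
  moreover have "g \<in> words X"
    using assms by (auto simp: g_def words_def in_lists_conv_set dest: in_set_takeD)
  ultimately show ?thesis
    by (auto simp: freely_conjugate_def)
qed

text \<open>A word fixed by a nontrivial rotation is a product of two commuting factors, and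
  commuting words are powers of a common word.\<close>

lemma proper_power_rotate:
  assumes "w \<in> words X" "0 < i" "i < length w" "rotate i w = w"
  shows "proper_power X w"
proof -
  have "drop i w @ take i w = take i w @ drop i w"
    using assms by (simp add: rotate_drop_take)
  then obtain m p v where v: "concat (replicate m v) = drop i w" "concat (replicate p v) = take i w"
    using comm_append_are_replicate by metis
  \<comment> \<open>Both factors are nonempty because \<open>i\<close> lies strictly between
    \<open>0\<close> and \<open>length w\<close>; hence the exponent \<open>p + m\<close> is at
    least two.\<close>
  have "m \<noteq> 0" "p \<noteq> 0"
    using v assms by (auto intro!: Nat.gr0I)
  have w: "w = concat (replicate (p + m) v)"
    using v by (simp add: replicate_add)
  have "set v \<subseteq> set w"
    using w \<open>m \<noteq> 0\<close> by auto
  then have "v \<in> words X"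
    using assms(1) by (auto simp: words_def)
  moreover have "free_eq w (concat (replicate (p + m) v))"
    using w by (simp add: free_eq_def)
  ultimately show ?thesis
    unfolding proper_power_def using \<open>m \<noteq> 0\<close> \<open>p \<noteq> 0\<close>
    by (metis One_nat_def Suc_leI add_mono neq0_conv one_add_one)
qed


section \<open>Complete bipartite multigraphs\<close>

text \<open>Injectivity of \<open>ends\<close> identifies each edge with its set of end points, so
  the vertex bijection alone determines the edge bijection.\<close>

lemma graph_iso_simple:
  assumes "inj_on (ends G) (edges G)" "inj_on (ends H) (edges H)"
    and f: "bij_betw f (verts G) (verts H)"
    and sub: "\<And>e. e \<in> edges G \<Longrightarrow> ends G e \<subseteq> verts G"
    and img: "(`) f ` ends G ` edges G = ends H ` edges H"
  shows "graph_iso G H"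
proof -
  define g where "g = inv_into (edges H) (ends H) \<circ> (`) f \<circ> ends G"
  have "inj_on ((`) f) (ends G ` edges G)"
    using f sub by (intro inj_on_image) (auto simp: bij_betw_def intro: inj_on_subset)
  then have "bij_betw ((`) f) (ends G ` edges G) (ends H ` edges H)"
    using img by (simp add: bij_betw_def)
  moreover have "bij_betw (ends G) (edges G) (ends G ` edges G)"
    using assms(1) by (simp add: bij_betw_def)
  moreover have "bij_betw (inv_into (edges H) (ends H)) (ends H ` edges H) (edges H)"
    using assms(2) by (intro bij_betw_inv_into) (simp add: bij_betw_def)
  ultimately have "bij_betw g (edges G) (edges H)"
    unfolding g_def by (meson bij_betw_trans)
  moreover have "ends H (g e) = f ` ends G e" if "e \<in> edges G" for e
  proof -
    have "f ` ends G e \<in> ends H ` edges H"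
      using that unfolding img [symmetric] by blast
    then show ?thesis
      by (simp add: g_def f_inv_into_f)
  qed
  ultimately show ?thesis
    using f unfolding graph_iso_def by blast
qed

section \<open>Walks, components and distances\<close>

lemma walk_verts: "walk G u es v \<Longrightarrow> u \<in> verts G \<and> v \<in> verts G"
  by (induction es arbitrary: u) auto

lemma walk_ConsI:
  "e \<in> edges G \<Longrightarrow> ends G e = {u, x} \<Longrightarrow> u \<in> verts G \<Longrightarrow> walk G x es v \<Longrightarrow> walk G u (e # es) v"
  by auto

lemma walk_append: "walk G u es v \<Longrightarrow> walk G v fs x \<Longrightarrow> walk G u (es @ fs) x"
  by (induction es arbitrary: u) auto

lemma reachable_refl: "u \<in> verts G \<Longrightarrow> reachable G u u"
  unfolding reachable_def by (rule exI[of _ "[]"]) simp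

lemma reachable_edge:
  assumes "reachable G u v" "e \<in> edges G" "ends G e = {v, x}" "x \<in> verts G"
  shows "reachable G u x"
proof -
  obtain es where es: "walk G u es v"
    using assms(1) by (auto simp: reachable_def)
  have "walk G v [e] x"
    using walk_verts[OF es] assms by (intro walk_ConsI[of e G v x]) simp_all
  then show ?thesis
    using walk_append[OF es] unfolding reachable_def by blast
qed

lemma walk_induced_subgraph:
  "walk (induced_subgraph G C) u es v \<Longrightarrow> C \<subseteq> verts G \<Longrightarrow> walk G u es v"
  by (induction es arbitrary: u) (auto simp: induced_subgraph_def)

lemma walk_invariant:
  assumes "walk G u es v"
    and "\<And>e u v. e \<in> edges G \<Longrightarrow> u \<in> ends G e \<Longrightarrow> v \<in> ends G e \<Longrightarrow> f u = f v"
  shows "f u = f v"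
  using assms(1)
proof (induction es arbitrary: u)
  case (Cons e es)
  then obtain x where "e \<in> edges G" "ends G e = {u, x}" "walk G x es v"
    by auto
  with Cons.IH[of x] assms(2)[of e u x] show ?case by simp
qed simp

text \<open>Constancy of \<open>f\<close> along edges keeps every walk inside one fibre of
  \<open>f\<close>, and reachability makes each fibre a whole component.\<close>

lemma components_eq:
  assumes "\<And>e u v. e \<in> edges G \<Longrightarrow> u \<in> ends G e \<Longrightarrow> v \<in> ends G e \<Longrightarrow> f u = f v"
    and "\<And>u v. u \<in> verts G \<Longrightarrow> v \<in> verts G \<Longrightarrow> f u = f v \<Longrightarrow> reachable G u v"
  shows "components G = (\<lambda>s. induced_subgraph G {u \<in> verts G. f u = s}) ` f ` verts G"
    and "card (components G) = card (f ` verts G)"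
proof -
  have "{u. reachable G v u} = {u \<in> verts G. f u = f v}" if "v \<in> verts G" for v
  proof (intro set_eqI iffI)
    fix u assume "u \<in> {u. reachable G v u}"
    then obtain es where w: "walk G v es u"
      by (auto simp: reachable_def)
    then have "f v = f u"
      using assms(1) by (rule walk_invariant)
    with walk_verts[OF w] show "u \<in> {u \<in> verts G. f u = f v}"
      by simp
  qed (use assms(2) that in auto)
  then show *: "components G = (\<lambda>s. induced_subgraph G {u \<in> verts G. f u = s}) ` f ` verts G"
    by (auto simp: components_def image_image)
  have "inj_on (\<lambda>s. induced_subgraph G {u \<in> verts G. f u = s}) (f ` verts G)"
    by (rule inj_onI) (auto simp: induced_subgraph_def)
  then show "card (components G) = card (f ` verts G)"
    unfolding * by (rule card_image)
qed

lemma distance_le: "walk G u es v \<Longrightarrow> distance G u v \<le> enat (length es)"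
  unfolding distance_def by (rule Inf_lower) auto

text \<open>A finite bound excludes the empty set of walks, whose infimum is infinity, and in
  \<open>enat\<close> the infimum of a nonempty set is attained.\<close>

lemma short_walk:
  assumes "distance G u v \<le> enat d"
  obtains es where "walk G u es v" "length es \<le> d"
proof -
  let ?L = "{enat (length es) |es. walk G u es v}"
  have "?L \<noteq> {}"
    using assms by (intro notI) (simp add: distance_def top_enat_def del: Collect_empty_eq)
  then have "Inf ?L \<in> ?L"
    unfolding Inf_enat_def by (metis (lifting) LeastI_ex all_not_in_conv)
  then obtain es where "walk G u es v" "distance G u v = enat (length es)"
    by (auto simp: distance_def)
  with assms show ?thesis
    by (intro that[of es]) auto
qed

lemma distance_le_diameter:
  "u \<in> verts G \<Longrightarrow> v \<in> verts G \<Longrightarrow> distance G u v \<le> diameter G"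
  unfolding diameter_def by (rule SUP_upper2) (auto intro: SUP_upper)

text \<open>Each edge switches between \<open>A\<close> and its complement. This form serves both
  the sides of a biclique and the sign of the letters in a star graph.\<close>

lemma walk_parity:
  assumes "walk G u es v"
    and "\<And>e. e \<in> edges G \<Longrightarrow> \<exists>x\<in>A. \<exists>y. y \<notin> A \<and> ends G e = {x, y}"
  shows "(u \<in> A \<longleftrightarrow> v \<in> A) \<longleftrightarrow> even (length es)"
  using assms(1)
proof (induction es arbitrary: u)
  case (Cons e es)
  then obtain x where x: "e \<in> edges G" "ends G e = {u, x}" "walk G x es v"
    by auto
  moreover obtain y z where "y \<in> A" "z \<notin> A" "ends G e = {y, z}"
    using assms(2) x(1) by blast
  ultimately have "(u \<in> A) \<noteq> (x \<in> A)"
    by (metis doubleton_eq_iff)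
  with Cons.IH[OF x(3)] show ?case by auto
qed simp

section \<open>Complete bipartite graphs, their invariants and isomorphisms\<close>

definition doubletons :: "'a set \<Rightarrow> 'a set \<Rightarrow> 'a set set" where
  "doubletons A B = (\<lambda>(a, b). {a, b}) ` (A \<times> B)"

lemma doubletonsI: "a \<in> A \<Longrightarrow> b \<in> B \<Longrightarrow> {a, b} \<in> doubletons A B"
  unfolding doubletons_def by (rule image_eqI[of _ _ "(a, b)"]) simp_all

lemma doubletonsE:
  assumes "S \<in> doubletons A B"
  obtains a b where "a \<in> A" "b \<in> B" "S = {a, b}"
  using assms unfolding doubletons_def by (elim imageE) (auto intro: that)

lemma doubletons_commute: "doubletons A B = doubletons B A"
proof -
  have "doubletons A B \<subseteq> doubletons B A" for A B :: "'a set"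
    by (rule subsetI, erule doubletonsE) (metis doubletonsI insert_commute)
  then show ?thesis by (intro subset_antisym)
qed

lemma doubletons_image: "doubletons (f ` A) (g ` B) = (\<lambda>(a, b). {f a, g b}) ` (A \<times> B)"
proof -
  have "f ` A \<times> g ` B = map_prod f g ` (A \<times> B)"
    by (simp add: map_prod_surj_on)
  then show ?thesis
    by (simp add: doubletons_def image_image split_def)
qed

lemma image_doubletons: "(`) f ` doubletons A B = doubletons (f ` A) (f ` B)"
  unfolding doubletons_image by (simp add: doubletons_def image_image split_def)

text \<open>The complete bipartite graph with prescribed sides, possibly empty; injectivity of
  \<open>ends\<close> is what excludes parallel edges.\<close>

definition biclique :: "('v, 'e) multigraph \<Rightarrow> 'v set \<Rightarrow> 'v set \<Rightarrow> bool" where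
  "biclique G A B \<longleftrightarrow> verts G = A \<union> B \<and> A \<inter> B = {} \<and> inj_on (ends G) (edges G) \<and>
     ends G ` edges G = doubletons A B"

lemma biclique_commute: "biclique G A B \<longleftrightarrow> biclique G B A"
  by (auto simp: biclique_def doubletons_commute Un_commute)

lemma biclique_verts: "biclique G A B \<Longrightarrow> verts G = A \<union> B"
  and biclique_disjoint: "biclique G A B \<Longrightarrow> A \<inter> B = {}"
  and biclique_inj: "biclique G A B \<Longrightarrow> inj_on (ends G) (edges G)"
  and biclique_ends: "biclique G A B \<Longrightarrow> ends G ` edges G = doubletons A B"
  by (simp_all add: biclique_def)

lemma biclique_edgeE:
  assumes "biclique G A B" "e \<in> edges G"
  obtains a b where "a \<in> A" "b \<in> B" "ends G e = {a, b}"
proof -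
  have "ends G e \<in> ends G ` edges G"
    using assms(2) by (rule imageI)
  then have "ends G e \<in> doubletons A B"
    by (simp only: biclique_ends[OF assms(1)])
  then show ?thesis by (rule doubletonsE) (rule that)
qed

lemma biclique_edge:
  assumes "biclique G A B" "a \<in> A" "b \<in> B"
  obtains e where "e \<in> edges G" "ends G e = {a, b}"
proof -
  have "{a, b} \<in> ends G ` edges G"
    using assms by (simp add: biclique_ends doubletonsI)
  then show ?thesis
    using that by auto
qed

lemma biclique_parity:
  assumes "biclique G A B" "walk G u es v"
  shows "(u \<in> A \<longleftrightarrow> v \<in> A) \<longleftrightarrow> even (length es)"
  using assms(2)
proof (rule walk_parity)
  fix e assume "e \<in> edges G"
  with assms(1) obtain a b where "a \<in> A" "b \<in> B" "ends G e = {a, b}"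
    by (rule biclique_edgeE)
  moreover from this have "b \<notin> A"
    using biclique_disjoint[OF assms(1)] by auto
  ultimately show "\<exists>x\<in>A. \<exists>y. y \<notin> A \<and> ends G e = {x, y}"
    by blast
qed

lemma biclique_short_walk:
  assumes "biclique G A B" "A \<noteq> {}" "B \<noteq> {}" "u \<in> verts G" "v \<in> verts G"
  obtains es where "walk G u es v" "length es \<le> 2"
proof -
  \<comment> \<open>Proved for arbitrary sides so that it can be reused with \<open>A\<close> and
    \<open>B\<close> exchanged. Two vertices on one side meet through any vertex of the
    other.\<close>
  have *: "\<exists>es. walk G u es v \<and> length es \<le> 2"
    if G: "biclique G A B" and ne: "B \<noteq> {}" and uv: "u \<in> A" "v \<in> verts G" for A B
  proof (cases "v \<in> A")
    case True
    obtain b where b: "b \<in> B" using ne by auto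
    obtain e where e: "e \<in> edges G" "ends G e = {u, b}"
      using G uv(1) b by (rule biclique_edge)
    obtain f where f: "f \<in> edges G" "ends G f = {v, b}"
      using G True b by (rule biclique_edge)
    have "walk G u [e, f] v"
      by (rule walk_ConsI[OF e], use uv biclique_verts[OF G] in simp,
          rule walk_ConsI[OF f(1) f(2)[unfolded insert_commute[of v]]])
        (use uv b biclique_verts[OF G] in simp_all)
    then show ?thesis by (intro exI[of _ "[e, f]"]) simp
  next
    case False
    then have "v \<in> B" using uv biclique_verts[OF G] by auto
    then obtain e where e: "e \<in> edges G" "ends G e = {u, v}"
      using biclique_edge[OF G uv(1)] by metis
    have "walk G u [e] v"
      by (rule walk_ConsI[OF e]) (use uv biclique_verts[OF G] in simp_all)
    then show ?thesis by (intro exI[of _ "[e]"]) simp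
  qed
  have "u \<in> A \<or> u \<in> B" using assms(4) biclique_verts[OF assms(1)] by auto
  then show ?thesis
  proof
    assume "u \<in> A"
    from *[OF assms(1,3) this assms(5)] that show ?thesis by blast
  next
    assume "u \<in> B"
    from *[OF biclique_commute[THEN iffD1, OF assms(1)] assms(2) this assms(5)] that show ?thesis by blast
  qed
qed

lemma biclique_connected:
  assumes "biclique G A B" "A \<noteq> {}" "B \<noteq> {}"
  shows "connected_graph G"
  unfolding connected_graph_def reachable_def
proof (intro conjI ballI)
  show "verts G \<noteq> {}"
    using assms(2) by (simp add: biclique_verts[OF assms(1)])
  fix u v assume "u \<in> verts G" "v \<in> verts G"
  then show "\<exists>es. walk G u es v"
    by (rule biclique_short_walk[OF assms]) blast
qed

lemma biclique_bipartite: "biclique G A B \<Longrightarrow> bipartite G"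
  unfolding bipartite_def
proof (intro exI conjI ballI)
  fix e assume "biclique G A B" "e \<in> edges G"
  then show "\<exists>a\<in>A. \<exists>b\<in>B. ends G e = {a, b}"
    by (rule biclique_edgeE) (intro bexI)
qed (rule biclique_verts biclique_disjoint, assumption)+

text \<open>Walks of length at most two always exist, while two distinct vertices on one side are at
  positive even distance.\<close>

lemma biclique_diameter:
  assumes G: "biclique G A B" and "B \<noteq> {}" and a: "a \<in> A" "a' \<in> A" "a \<noteq> a'"
  shows "diameter G = 2"
proof (rule antisym)
  show "diameter G \<le> 2"
    unfolding diameter_def
  proof (intro SUP_least)
    fix u v assume "u \<in> verts G" "v \<in> verts G"
    then obtain es where "walk G u es v" "length es \<le> 2"
      using biclique_short_walk[OF G] assms by (metis empty_iff)
    with distance_le[of G u es v] show "distance G u v \<le> 2"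
      by (metis enat_ord_simps(1) numeral_eq_enat order_trans)
  qed
  have "2 \<le> distance G a a'"
    unfolding distance_def
  proof (rule Inf_greatest, safe)
    fix es assume w: "walk G a es a'"
    then have "even (length es)"
      using biclique_parity[OF G w] a by simp
    moreover have "length es \<noteq> 0"
      using w a by auto
    ultimately have "2 \<le> length es" by presburger
    then show "2 \<le> enat (length es)" by (simp add: numeral_eq_enat)
  qed
  also have "\<dots> \<le> diameter G"
    using a biclique_verts[OF G] by (intro distance_le_diameter) auto
  finally show "2 \<le> diameter G" .
qed

text \<open>Two vertices on each side span a four-cycle. Closed walks have even length, and one of
  length two with distinct edges would consist of parallel edges.\<close>

lemma biclique_girth:
  assumes G: "biclique G A B" and a: "a \<in> A" "a' \<in> A" "a \<noteq> a'" and b: "b \<in> B" "b' \<in> B" "b \<noteq> b'"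
  shows "girth G = 4"
proof (rule antisym)
  have *: "\<exists>e. e \<in> edges G \<and> ends G e = {x, y}" if "x \<in> A" "y \<in> B" for x y
    using biclique_edge[OF G that] by metis
  obtain e1 e2 e3 e4 where e: "e1 \<in> edges G" "ends G e1 = {a, b}" "e2 \<in> edges G" "ends G e2 = {a', b}"
      "e3 \<in> edges G" "ends G e3 = {a', b'}" "e4 \<in> edges G" "ends G e4 = {a, b'}"
    using *[of a b] *[of a' b] *[of a' b'] *[of a b'] a b by metis
  have v: "a \<in> verts G" "a' \<in> verts G" "b \<in> verts G" "b' \<in> verts G"
    using a b biclique_verts[OF G] by auto
  have "walk G a [e1, e2, e3, e4] a"
    using walk_ConsI[of e1 G a b "[e2, e3, e4]" a] walk_ConsI[of e2 G b a' "[e3, e4]" a]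
      walk_ConsI[of e3 G a' b' "[e4]" a] walk_ConsI[of e4 G b' a "[]" a] e v
    by (simp add: insert_commute del: walk.simps(2))
  moreover have "distinct_adj [e1, e2, e3, e4]"
    using e a b by (auto simp: doubleton_eq_iff)
  ultimately show "girth G \<le> 4"
    unfolding girth_def by (intro Inf_lower CollectI exI[of _ a] exI[of _ "[e1, e2, e3, e4]"])
      (auto simp: numeral_eq_enat)
  show "4 \<le> girth G"
    unfolding girth_def
  proof (rule Inf_greatest, safe)
    fix u es assume w: "walk G u es u" and d: "distinct_adj es" and ne: "es \<noteq> []"
    have ev: "even (length es)"
      using biclique_parity[OF G w] by simp
    have "length es \<noteq> 2"
    proof
      assume "length es = 2"
      then obtain e f where es: "es = [e, f]"
        by (auto simp: length_Suc_conv numeral_2_eq_2)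
      then have "e \<in> edges G" "f \<in> edges G" "ends G e = ends G f"
        using w by (auto simp: insert_commute)
      then have "e = f"
        using biclique_inj[OF G] by (auto dest: inj_onD)
      then show False using d es by simp
    qed
    with ev ne have "4 \<le> length es"
      by (cases es) (auto, presburger)
    then show "4 \<le> enat (length es)" by (simp add: numeral_eq_enat)
  qed
qed

lemma biclique_degree:
  assumes G: "biclique G A B" and a: "a \<in> A"
  shows "degree G a = card B"
proof -
  have not_B: "x \<notin> B" if "x \<in> A" for x
    using that biclique_disjoint[OF G] by auto
  have "ends G ` {e \<in> edges G. a \<in> ends G e} = (\<lambda>b. {a, b}) ` B"
  proof (intro subset_antisym subsetI)
    fix S assume "S \<in> ends G ` {e \<in> edges G. a \<in> ends G e}"
    then obtain e where e: "e \<in> edges G" "a \<in> ends G e" "S = ends G e" by auto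
    obtain a' b where ab: "a' \<in> A" "b \<in> B" "ends G e = {a', b}"
      using G e(1) by (rule biclique_edgeE)
    have "a = a' \<or> a = b" using e(2) ab(3) by simp
    then have "a' = a" using ab(2) not_B[OF a] by auto
    with ab e(3) show "S \<in> (\<lambda>b. {a, b}) ` B" by simp
  next
    fix S assume "S \<in> (\<lambda>b. {a, b}) ` B"
    then obtain b where b: "b \<in> B" "S = {a, b}" by auto
    obtain e where e: "e \<in> edges G" "ends G e = {a, b}"
      using G a b(1) by (rule biclique_edge)
    show "S \<in> ends G ` {e \<in> edges G. a \<in> ends G e}"
      by (rule image_eqI[of _ _ e]) (simp_all add: e b(2))
  qed
  moreover have "card (ends G ` {e \<in> edges G. a \<in> ends G e}) = card {e \<in> edges G. a \<in> ends G e}"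
    by (rule card_image, rule inj_on_subset[OF biclique_inj[OF G]]) simp
  moreover have "card ((\<lambda>b. {a, b}) ` B) = card B"
    by (rule card_image, rule inj_onI) (auto simp: doubleton_eq_iff)
  ultimately have "card {e \<in> edges G. a \<in> ends G e} = card B"
    by simp
  \<comment> \<open>The second summand of \<open>degree\<close> counts loops, which disjointness of
    the sides excludes.\<close>
  moreover have "{e \<in> edges G. ends G e = {a}} = {}"
  proof -
    have "ends G e \<noteq> {a}" if e: "e \<in> edges G" for e
    proof
      assume a: "ends G e = {a}"
      obtain a' b where ab: "a' \<in> A" "b \<in> B" "ends G e = {a', b}"
        using G e by (rule biclique_edgeE)
      then have "a' \<in> {a}" "b \<in> {a}" unfolding a [symmetric] by simp_all
      with ab not_B[of a'] show False by simp
    qed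
    then show ?thesis by simp
  qed
  ultimately show ?thesis
    unfolding degree_def by (simp only: card.empty)
qed

lemma bij_betw_glue:
  assumes f: "bij_betw f A C" and g: "bij_betw g B D" and "A \<inter> B = {}" "C \<inter> D = {}"
  obtains h where "bij_betw h (A \<union> B) (C \<union> D)" "\<And>x. x \<in> A \<Longrightarrow> h x = f x" "\<And>x. x \<in> B \<Longrightarrow> h x = g x"
proof
  let ?h = "\<lambda>x. if x \<in> A then f x else g x"
  show hA: "?h x = f x" if "x \<in> A" for x using that by simp
  show hB: "?h x = g x" if "x \<in> B" for x using that assms(3) by auto
  have "bij_betw ?h A C" "bij_betw ?h B D"
    using f g bij_betw_cong[of A ?h f C] bij_betw_cong[of B ?h g D] hA hB by blast+
  then show "bij_betw ?h (A \<union> B) (C \<union> D)"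
    using assms(4) by (rule bij_betw_combine)
qed

lemma bij_betw_glue_image:
  assumes "finite A" "finite B" "finite C" "finite D" "card A = card C" "card B = card D"
    and "A \<inter> B = {}" "C \<inter> D = {}"
  obtains h where "bij_betw h (A \<union> B) (C \<union> D)" "h ` A = C" "h ` B = D"
proof -
  obtain f g where f: "bij_betw f A C" and g: "bij_betw g B D"
    using assms finite_same_card_bij by metis
  obtain h where h: "bij_betw h (A \<union> B) (C \<union> D)" "\<And>x. x \<in> A \<Longrightarrow> h x = f x" "\<And>x. x \<in> B \<Longrightarrow> h x = g x"
    using bij_betw_glue[OF f g assms(7,8)] by metis
  then have "h ` A = C" "h ` B = D"
    using f g by (simp_all add: bij_betw_def)
  with h(1) show ?thesis by (rule that)
qed

lemma biclique_graph_iso: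
  assumes G: "biclique G A B" and H: "biclique H C D"
    and "finite A" "finite B" "finite C" "finite D" "card A = card C" "card B = card D"
  shows "graph_iso G H"
proof -
  obtain h where h: "bij_betw h (A \<union> B) (C \<union> D)" "h ` A = C" "h ` B = D"
    by (rule bij_betw_glue_image[of A B C D])
      (use assms biclique_disjoint[OF G] biclique_disjoint[OF H] in auto)
  show ?thesis
  proof (rule graph_iso_simple[where f = h])
    show "(`) h ` ends G ` edges G = ends H ` edges H"
      using h by (simp add: biclique_ends[OF G] biclique_ends[OF H] image_doubletons)
    show "ends G e \<subseteq> verts G" if "e \<in> edges G" for e
      by (rule biclique_edgeE[OF G that]) (simp add: biclique_verts[OF G])
  qed (use h in \<open>simp_all add: biclique_verts[OF G] biclique_verts[OF H] biclique_inj[OF G] biclique_inj[OF H]\<close>)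
qed

lemma biclique_complete_bipartite:
  "biclique (complete_bipartite a b) (Inl ` {..<a}) (Inr ` {..<b})"
  unfolding biclique_def
proof (intro conjI)
  show "inj_on (ends (complete_bipartite a b)) (edges (complete_bipartite a b))"
    by (auto simp: complete_bipartite_def inj_on_def doubleton_eq_iff)
  show "ends (complete_bipartite a b) ` edges (complete_bipartite a b)
      = doubletons (Inl ` {..<a}) (Inr ` {..<b})"
    by (simp add: complete_bipartite_def doubletons_image)
qed (auto simp: complete_bipartite_def Plus_def)

text \<open>Bijections are glued twice, first from the sides to each half and then across the
  halves; \<open>graph_iso_simple\<close> supplies the edge map.\<close>

lemma graph_iso_two_bicliques:
  assumes inj: "inj_on (ends G) (edges G)"
    and verts: "verts G = (A \<union> B) \<union> (C \<union> D)" "(A \<union> B) \<inter> (C \<union> D) = {}" "A \<inter> B = {}" "C \<inter> D = {}"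
    and ends: "ends G ` edges G =
      doubletons A B \<union> doubletons C D"
    and fin: "finite A" "finite B" "finite C" "finite D"
  shows "graph_iso G (disjoint_union (complete_bipartite (card A) (card B))
                                     (complete_bipartite (card C) (card D)))"
    (is "graph_iso G ?H")
proof -
  let ?A = "Inl ` Inl ` {..<card A} :: ((nat + nat) + (nat + nat)) set"
  let ?B = "Inl ` Inr ` {..<card B} :: ((nat + nat) + (nat + nat)) set"
  let ?C = "Inr ` Inl ` {..<card C} :: ((nat + nat) + (nat + nat)) set"
  let ?D = "Inr ` Inr ` {..<card D} :: ((nat + nat) + (nat + nat)) set"
  have card: "card A = card ?A" "card B = card ?B" "card C = card ?C" "card D = card ?D"
    by (simp_all add: card_image)
  obtain f where f: "bij_betw f (A \<union> B) (?A \<union> ?B)" "f ` A = ?A" "f ` B = ?B"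
    by (rule bij_betw_glue_image[of A B ?A ?B]) (use assms card in auto)
  obtain g where g: "bij_betw g (C \<union> D) (?C \<union> ?D)" "g ` C = ?C" "g ` D = ?D"
    by (rule bij_betw_glue_image[of C D ?C ?D]) (use assms card in auto)
  have "(?A \<union> ?B) \<inter> (?C \<union> ?D) = {}" by auto
  then obtain h where h: "bij_betw h ((A \<union> B) \<union> (C \<union> D)) ((?A \<union> ?B) \<union> (?C \<union> ?D))"
      and hf: "\<And>x. x \<in> A \<union> B \<Longrightarrow> h x = f x" and hg: "\<And>x. x \<in> C \<union> D \<Longrightarrow> h x = g x"
    using bij_betw_glue[OF f(1) g(1) verts(2)] by metis
  have img: "h ` A = ?A" "h ` B = ?B" "h ` C = ?C" "h ` D = ?D"
    unfolding f(2,3) [symmetric] g(2,3) [symmetric] by (auto intro!: image_cong simp: hf hg)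
  show ?thesis
  proof (rule graph_iso_simple[where f = h])
    show "bij_betw h (verts G) (verts ?H)"
      using h by (simp add: verts disjoint_union_def complete_bipartite_def Plus_def image_Un)
    have "ends ?H ` edges ?H =
        doubletons ?A ?B \<union> doubletons ?C ?D"
      by (simp add: disjoint_union_def complete_bipartite_def Plus_def doubletons_image image_image
          image_Un split_def)
    then show "(`) h ` ends G ` edges G = ends ?H ` edges ?H"
      unfolding ends image_Un image_doubletons img by simp
    show "inj_on (ends ?H) (edges ?H)"
      by (auto simp: inj_on_def disjoint_union_def complete_bipartite_def doubleton_eq_iff)
    show "ends G e \<subseteq> verts G" if "e \<in> edges G" for e
    proof -
      have "ends G e \<in> doubletons A B \<union> doubletons C D" using that ends by blast
      then show ?thesis unfolding verts by (auto elim: doubletonsE)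
    qed
  qed (rule inj)
qed


section \<open>Affine sets of residues\<close>

text \<open>The translations \<open>T\<close> preserving \<open>S\<close> modulo \<open>n\<close>
  form a subgroup of the integers containing \<open>n\<close>, generated by its least positive
  element \<open>d\<close>. Closure puts all differences of elements of \<open>S\<close> into
  \<open>T\<close>, so \<open>S\<close> consists of the representatives in \<open>{0..<n}\<close> of
  one coset of \<open>T\<close>.\<close>

lemma affine_closed_residues:
  fixes S :: "int set" and n :: int
  assumes n: "0 < n" and S: "S \<subseteq> {0..<n}" "S \<noteq> {}"
    and closed: "\<And>a b c. a \<in> S \<Longrightarrow> b \<in> S \<Longrightarrow> c \<in> S \<Longrightarrow> (a - b + c) mod n \<in> S"
  obtains d r where "0 < d" "d dvd n" "0 \<le> r" "r < d" "S = {x \<in> {0..<n}. x mod d = r}"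
proof -
  define T where "T = {t. \<forall>s\<in>S. (s + t) mod n \<in> S}"
  obtain s0 where s0: "s0 \<in> S" using S(2) by blast
  have mod_S: "s mod n = s" if "s \<in> S" for s using S(1) that by auto
  have T_n: "n \<in> T" using mod_S by (simp add: T_def)
  have T_add: "s + t \<in> T" if "s \<in> T" "t \<in> T" for s t
  proof -
    have "(u + (s + t)) mod n \<in> S" if "u \<in> S" for u
    proof -
      have "((u + s) mod n + t) mod n \<in> S"
        using that \<open>s \<in> T\<close> \<open>t \<in> T\<close> by (simp add: T_def)
      then show ?thesis by (simp add: mod_simps add.assoc)
    qed
    then show ?thesis by (simp add: T_def)
  qed
  have T_uminus: "- t \<in> T" if "t \<in> T" for t
  proof -
    have "(s + - t) mod n \<in> S" if "s \<in> S" for s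
    proof -
      \<comment> \<open>The translate \<open>s - t\<close> is written as
        \<open>s - (s0 + t) + s0\<close>, an affine combination of three elements of
        \<open>S\<close> modulo \<open>n\<close>.\<close>
      have "(s0 + t) mod n \<in> S" using s0 \<open>t \<in> T\<close> by (simp add: T_def)
      then have "(s - (s0 + t) mod n + s0) mod n \<in> S"
        using closed that s0 by blast
      moreover have "(s - (s0 + t) mod n + s0) mod n = (s - (s0 + t) + s0) mod n"
        by (metis mod_add_left_eq mod_diff_right_eq)
      ultimately show ?thesis by simp
    qed
    then show ?thesis by (simp add: T_def)
  qed
  have T_0: "0 \<in> T" using T_add[OF T_n T_uminus[OF T_n]] by simp
  have T_nat_mult: "int m * t \<in> T" if "t \<in> T" for m t
    by (induction m) (use T_0 T_add that in \<open>auto simp: distrib_right\<close>)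
  have T_mult: "m * t \<in> T" if "t \<in> T" for m t
    using T_nat_mult[OF that, of "nat m"] T_uminus[OF T_nat_mult[OF that, of "nat (- m)"]]
    by (cases "0 \<le> m") simp_all
  have T_diff: "a - b \<in> T" if "a \<in> S" "b \<in> S" for a b
  proof -
    have "(c + (a - b)) mod n \<in> S" if "c \<in> S" for c
      using closed[OF \<open>a \<in> S\<close> \<open>b \<in> S\<close> that] by (simp add: algebra_simps)
    then show ?thesis by (simp add: T_def)
  qed
  define d where "d = int (LEAST m. 0 < m \<and> int m \<in> T)"
  have ex: "0 < nat n \<and> int (nat n) \<in> T" using n T_n by simp
  have d: "0 < d" "d \<in> T"
    using LeastI[of "\<lambda>m. 0 < m \<and> int m \<in> T", OF ex] by (simp_all add: d_def)
  have d_dvd: "d dvd t" if "t \<in> T" for t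
  proof (rule ccontr)
    assume "\<not> d dvd t"
    then have pos: "0 < t mod d" using d(1) by (simp add: dvd_eq_mod_eq_0 le_neq_trans)
    \<comment> \<open>Division with remainder: a nonzero remainder in \<open>T\<close> would be a
      positive element below the least one.\<close>
    have "t mod d = t + - (t div d * d)" by (simp add: minus_div_mult_eq_mod)
    then have "t mod d \<in> T" using T_add that T_uminus T_mult d(2) by metis
    then have "(LEAST m. 0 < m \<and> int m \<in> T) \<le> nat (t mod d)"
      using pos by (intro Least_le) simp
    then have "d \<le> int (nat (t mod d))"
      by (simp only: d_def zle_int)
    then show False using pos pos_mod_bound[OF d(1), of t] by simp
  qed
  have "S = {x \<in> {0..<n}. x mod d = s0 mod d}"
  proof (intro subset_antisym subsetI)
    fix x assume "x \<in> S"
    then show "x \<in> {x \<in> {0..<n}. x mod d = s0 mod d}"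
      using S(1) d_dvd[OF T_diff[OF _ s0]] by (auto simp: mod_eq_dvd_iff)
  next
    fix x assume x: "x \<in> {x \<in> {0..<n}. x mod d = s0 mod d}"
    then have "d dvd x - s0" by (simp add: mod_eq_dvd_iff)
    then have "x - s0 \<in> T" using T_mult[OF d(2)] by (metis dvdE mult.commute)
    then have "(s0 + (x - s0)) mod n \<in> S" using s0 by (auto simp: T_def)
    then show "x \<in> S" using x by simp
  qed
  then show ?thesis
    using d(1) d_dvd[OF T_n] by (intro that[of d "s0 mod d"]) simp_all
qed

lemma residue_class_eq_image:
  fixes d r :: int
  assumes "0 < d" "0 \<le> r" "r < d"
  shows "{x \<in> {0..<d * int k}. x mod d = r} = (\<lambda>j. r + d * int j) ` {..<k}"
proof (intro subset_antisym subsetI)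
  fix x assume x: "x \<in> {x \<in> {0..<d * int k}. x mod d = r}"
  then have "x = r + d * int (nat (x div d))"
    using assms by (simp add: pos_imp_zdiv_nonneg_iff) (metis add.commute mult_div_mod_eq)
  moreover have "d * (x div d) < d * int k"
    using x assms mult_div_mod_eq[of d x] by (smt (verit) mem_Collect_eq atLeastLessThan_iff)
  then have "nat (x div d) < k"
    using x assms by (simp add: nat_less_iff pos_imp_zdiv_nonneg_iff)
  ultimately show "x \<in> (\<lambda>j. r + d * int j) ` {..<k}" by blast
next
  fix x assume "x \<in> (\<lambda>j. r + d * int j) ` {..<k}"
  then obtain j where j: "j < k" "x = r + d * int j" by blast
  have "r + d * int j < d * (int j + 1)" using assms by (simp add: distrib_left)
  also have "\<dots> \<le> d * int k" using j assms by (intro mult_left_mono) auto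
  finally show "x \<in> {x \<in> {0..<d * int k}. x mod d = r}"
    using j assms by (simp add: mod_pos_pos_trivial)
qed

text \<open>The sum of an arithmetic progression, doubled to avoid a division by two.\<close>

lemma double_sum_arith: "2 * (\<Sum>j<k. r + d * int j) = int k * (2 * r + d * (int k - 1))"
  by (induction k) (auto simp: algebra_simps)

text \<open>Doubling the sum and cancelling \<open>k\<close> gives
  \<open>2 * r + d * (k - 1) = 2 * (d * m)\<close>. So \<open>d\<close> divides
  \<open>2 * r\<close>, coprimality leaves \<open>d \<le> 2\<close>, and the same equation fixes the
  parity of \<open>k\<close>.\<close>

lemma arith_sum_dvd_cases:
  fixes d r :: int and k :: nat
  assumes d: "0 < d" "0 \<le> r" "r < d" and k: "0 < k" and gcd: "gcd d r = 1"
    and dvd: "d * int k dvd (\<Sum>j<k. r + d * int j)"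
  shows "(d = 1 \<and> r = 0 \<and> odd k) \<or> (d = 2 \<and> r = 1 \<and> even k)"
proof -
  obtain m where "(\<Sum>j<k. r + d * int j) = d * int k * m" using dvd by (elim dvdE)
  then have "int k * (2 * r + d * (int k - 1)) = int k * (2 * (d * m))"
    using double_sum_arith[of r d k] by (simp add: algebra_simps)
  then have eq: "2 * r + d * (int k - 1) = 2 * (d * m)"
    using k by simp
  then have "2 * r = d * (2 * m - (int k - 1))" by (simp add: algebra_simps)
  then have "d dvd 2 * r" by simp
  moreover have "coprime d r" using gcd by (simp add: coprime_iff_gcd_eq_1)
  ultimately have "d dvd 2" by (simp add: coprime_dvd_mult_left_iff)
  then have "d \<le> 2" by (rule zdvd_imp_le) simp
  then consider "d = 1" | "d = 2" using d(1) by linarith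
  then show ?thesis
  proof cases
    case 1
    with d eq have "r = 0" "int k = 2 * m + 1" by auto
    then have "odd (int k)" by simp
    with 1 \<open>r = 0\<close> show ?thesis by simp
  next
    case 2
    with d gcd have "r = 1" by (cases "r = 0") auto
    with 2 eq have "int k = 2 * m" by simp
    then have "even (int k)" by simp
    with 2 \<open>r = 1\<close> show ?thesis by simp
  qed
qed

text \<open>Equal supports give the image, and equal sizes then force injectivity. This turns an
  equation for the multiset of steps into a statement about the step function.\<close>

lemma image_mset_eq_mset_set_iff:
  assumes "finite A" "finite S"
  shows "image_mset f (mset_set A) = mset_set S \<longleftrightarrow> inj_on f A \<and> f ` A = S"
proof
  assume eq: "image_mset f (mset_set A) = mset_set S"
  have "set_mset (image_mset f (mset_set A)) = set_mset (mset_set S)"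
    by (simp only: eq)
  then have img: "f ` A = S"
    using assms by simp
  have "size (image_mset f (mset_set A)) = size (mset_set S)"
    by (simp only: eq)
  then have "card A = card S"
    using assms by simp
  with img assms show "inj_on f A \<and> f ` A = S"
    by (auto intro: eq_card_imp_inj_on)
qed (auto simp: image_mset_mset_set)

lemma card_residue_class:
  assumes "s < d"
  shows "card {c. c < d * k \<and> c mod d = s} = k"
proof -
  have "{c. c < d * k \<and> c mod d = s} = (\<lambda>j. s + d * j) ` {..<k}"
  proof (intro subset_antisym subsetI)
    fix c assume c: "c \<in> {c. c < d * k \<and> c mod d = s}"
    then have "c = s + d * (c div d)" "c div d < k"
      by (auto simp: less_mult_imp_div_less mult.commute)
    then show "c \<in> (\<lambda>j. s + d * j) ` {..<k}" by blast
  next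
    fix c assume "c \<in> (\<lambda>j. s + d * j) ` {..<k}"
    then obtain j where j: "j < k" "c = s + d * j" by blast
    have "s + d * j < d * Suc j" using assms by simp
    also have "\<dots> \<le> d * k" using j by (intro mult_le_mono2) simp
    finally show "c \<in> {c. c < d * k \<and> c mod d = s}" using j assms by simp
  qed
  moreover have "inj_on (\<lambda>j. s + d * j) {..<k}"
    using assms by (auto simp: inj_on_def)
  ultimately show ?thesis by (simp add: card_image)
qed

text \<open>The right-hand residue is the predecessor of \<open>s\<close> modulo \<open>d\<close>,
  which wraps around at zero.\<close>

lemma Suc_mod_eq_iff:
  "s < d \<Longrightarrow> Suc e mod d = s \<longleftrightarrow> e mod d = (if s = 0 then d - 1 else s - 1)"
  by (auto simp: mod_Suc)


section \<open>Star graphs of positive cyclic presentations\<close>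

text \<open>The word \<open>y x\<^sup>-\<^sup>1 u\<^sup>-\<^sup>1\<close> that is paired with \<open>x y\<^sup>-\<^sup>1 u\<close> in an edge of the star graph.\<close>

definition flip_word :: "'a word \<Rightarrow> 'a word" where
  "flip_word p = rotate (length p - 2) (inv_word p)"

text \<open>Inversion moves the first two letters, reversed and inverted, to the end; rotating by
  the length of the rest brings them back to the front.\<close>

lemma flip_word_Cons: "flip_word (x # y # u) = inv_letter y # inv_letter x # inv_word u"
proof -
  have "flip_word (x # y # u) = rotate (length (inv_word u)) (inv_word u @ [inv_letter y, inv_letter x])"
    by (simp add: flip_word_def)
  then show ?thesis
    by (simp only: rotate_append) simp
qed

lemma length_two_cases:
  assumes "2 \<le> length p"
  obtains x y u where "p = x # inv_letter y # u"
proof -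
  obtain x y u where "p = x # y # u"
    using assms by (metis Suc_le_length_iff numeral_2_eq_2)
  then show ?thesis
    using that[of x "inv_letter y" u] by simp
qed

lemma flip_word_flip_word: "2 \<le> length p \<Longrightarrow> flip_word (flip_word p) = p"
  by (elim length_two_cases) (simp add: flip_word_Cons)

text \<open>An edge given by a rotation of an inverse relator is also given by a rotation of the
  relator itself, so every edge has a positive representative when the relators are
  positive.\<close>

lemma flip_word_rotate_inv_word: "\<exists>i. flip_word (rotate m (inv_word r)) = rotate i r"
proof -
  obtain i where "inv_word (rotate m (inv_word r)) = rotate i (inv_word (inv_word r))"
    using inv_word_rotate by blast
  then have "flip_word (rotate m (inv_word r)) = rotate (length r - 2 + i) r"
    by (simp add: flip_word_def rotate_rotate)
  then show ?thesis ..
qed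

lemma edges_star_graph:
  "edges (star_graph P) = {{p, flip_word p} | p. p \<in> sym_closure P \<and> 2 \<le> length p}"
proof (intro subset_antisym subsetI)
  fix e assume "e \<in> edges (star_graph P)"
  then obtain x y u where e: "e = {x # inv_letter y # u, y # inv_letter x # inv_word u}"
      and p: "x # inv_letter y # u \<in> sym_closure P"
    by (auto simp: star_graph_def)
  show "e \<in> {{p, flip_word p} | p. p \<in> sym_closure P \<and> 2 \<le> length p}"
    by (rule CollectI, rule exI[of _ "x # inv_letter y # u"]) (simp add: e p flip_word_Cons)
next
  fix e assume "e \<in> {{p, flip_word p} | p. p \<in> sym_closure P \<and> 2 \<le> length p}"
  then obtain p where e: "e = {p, flip_word p}" "p \<in> sym_closure P" "2 \<le> length p"
    by blast
  obtain x y u where p: "p = x # inv_letter y # u"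
    using e(3) by (rule length_two_cases)
  show "e \<in> edges (star_graph P)"
    unfolding star_graph_def multigraph.simps
    by (rule CollectI, rule exI[of _ x], rule exI[of _ y], rule exI[of _ u])
      (use e p in \<open>simp add: flip_word_Cons\<close>)
qed

lemma ends_star_graph:
  assumes "2 \<le> length p"
  shows "ends (star_graph P) {p, flip_word p} = {p ! 0, inv_letter (p ! 1)}"
  using assms by (elim length_two_cases) (simp add: star_graph_def flip_word_Cons)

lemma shift_funpow:
  assumes "w \<in> words {..<n}"
  shows "(shift n ^^ j) w = map (\<lambda>(i, e). ((i + j) mod n, e)) w"
proof (induction j)
  case 0
  \<comment> \<open>Even for \<open>j = 0\<close> the formula reduces modulo \<open>n\<close>, which
    is harmless because all subscripts are below \<open>n\<close>.\<close>
  have "map (\<lambda>(i, e). ((i + 0) mod n, e)) w = map (\<lambda>x. x) w"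
    using assms by (intro map_cong) (auto simp: words_def in_lists_conv_set)
  then show ?case by simp
next
  case (Suc j)
  then show ?case
    by (simp add: shift_def split_def mod_Suc_eq)
qed

section \<open>Edges of the star graph as rotations of relators\<close>

locale positive_cyclic_word =
  fixes n :: nat and w :: "nat word"
  assumes n_pos: "0 < n"
    and w_words: "w \<in> words {..<n}"
    and w_positive: "positive w"
    and length_w: "2 \<le> length w"
begin

abbreviation P :: "nat presentation" where "P \<equiv> cyclic_presentation n w"

abbreviation \<Gamma> :: "(nat letter, nat word set) multigraph" where "\<Gamma> \<equiv> star_graph P"

abbreviation k :: nat where "k \<equiv> length w"

definition subscript :: "nat \<Rightarrow> nat" where "subscript i = fst (w ! i)"

definition step :: "nat \<Rightarrow> nat" where
  "step i = nat ((int (subscript (Suc i mod k)) - int (subscript i)) mod int n)"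

definition rotation :: "nat \<Rightarrow> nat \<Rightarrow> nat word" where
  "rotation j i = rotate i ((shift n ^^ j) w)"

definition edge :: "nat \<Rightarrow> nat \<Rightarrow> nat word set" where
  "edge j i = {rotation j i, flip_word (rotation j i)}"

lemma w_nonempty [simp]: "w \<noteq> []"
  using length_w by auto

lemma k_pos: "0 < k"
  by simp

lemma subscript_less: "i < k \<Longrightarrow> subscript i < n"
  using w_words nth_mem[of i w]
  by (auto simp: subscript_def words_def in_lists_conv_set mem_Times_iff)

lemma w_nth: "i < k \<Longrightarrow> w ! i = (subscript i, True)"
  using w_positive by (simp add: subscript_def positive_def prod_eq_iff)

lemma shift_words: "(shift n ^^ j) w \<in> words {..<n}"
  using n_pos by (auto simp: shift_funpow[OF w_words] words_def in_lists_conv_set)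

lemma shift_positive: "positive ((shift n ^^ j) w)"
  using w_positive by (auto simp: shift_funpow[OF w_words] positive_def)

lemma length_shift: "length ((shift n ^^ j) w) = k"
  by (simp add: shift_funpow[OF w_words])

lemma length_rotation: "length (rotation j i) = k"
  by (simp add: rotation_def length_shift)

lemma rotation_positive: "positive (rotation j i)"
  using shift_positive by (simp add: rotation_def positive_def)

lemma rotation_nth:
  assumes "i < k" "m < k"
  shows "rotation j i ! m = ((subscript ((i + m) mod k) + j) mod n, True)"
  using assms k_pos by (simp add: rotation_def nth_rotate length_shift)
    (simp add: shift_funpow[OF w_words] w_nth)

lemma rels_P: "rels P = (\<lambda>j. (shift n ^^ j) w) ` {..<n}"
  by (simp add: cyclic_presentation_def)

lemma sym_closure_P:
  "p \<in> sym_closure P \<longleftrightarrow> (\<exists>j<n. \<exists>m. p = rotate m ((shift n ^^ j) w) \<or> p = rotate m (inv_word ((shift n ^^ j) w)))"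
  unfolding sym_closure_def rels_P by blast

lemma rotate_shift: "rotate m ((shift n ^^ j) w) = rotation j (m mod k)"
  unfolding rotation_def by (metis length_shift rotate_conv_mod)

lemma edges_\<Gamma>: "edges \<Gamma> = (\<lambda>(j, i). edge j i) ` ({..<n} \<times> {..<k})"
proof (intro subset_antisym subsetI)
  fix e assume "e \<in> edges \<Gamma>"
  then obtain p where e: "e = {p, flip_word p}" and p: "p \<in> sym_closure P" and len: "2 \<le> length p"
    unfolding edges_star_graph by blast
  from p obtain j m where j: "j < n"
      and "p = rotate m ((shift n ^^ j) w) \<or> p = rotate m (inv_word ((shift n ^^ j) w))"
    unfolding sym_closure_P by blast
  then have "\<exists>i. p = rotate i ((shift n ^^ j) w) \<or> flip_word p = rotate i ((shift n ^^ j) w)"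
    using flip_word_rotate_inv_word by blast
  then obtain i where "p = rotation j (i mod k) \<or> flip_word p = rotation j (i mod k)"
    unfolding rotate_shift by blast
  then have "e = edge j (i mod k)"
    using flip_word_flip_word[OF len] by (auto simp: e edge_def)
  then show "e \<in> (\<lambda>(j, i). edge j i) ` ({..<n} \<times> {..<k})"
    using j k_pos by (intro image_eqI[of _ _ "(j, i mod k)"]) simp_all
next
  fix e assume "e \<in> (\<lambda>(j, i). edge j i) ` ({..<n} \<times> {..<k})"
  then obtain j i where e: "e = edge j i" and "j < n" by auto
  then have "rotation j i \<in> sym_closure P"
    unfolding sym_closure_P rotation_def by blast
  then show "e \<in> edges \<Gamma>"
    unfolding edges_star_graph e edge_def using length_w
    by (intro CollectI exI[of _ "rotation j i"]) (simp add: length_rotation)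
qed

lemma edge_in_edges: "j < n \<Longrightarrow> i < k \<Longrightarrow> edge j i \<in> edges \<Gamma>"
  unfolding edges_\<Gamma> by (rule image_eqI[of _ _ "(j, i)"]) simp_all

lemma ends_edge:
  assumes "i < k"
  shows "ends \<Gamma> (edge j i) =
    {((subscript i + j) mod n, True), ((subscript (Suc i mod k) + j) mod n, False)}"
proof -
  have "ends \<Gamma> (edge j i) = {rotation j i ! 0, inv_letter (rotation j i ! 1)}"
    unfolding edge_def using length_w by (intro ends_star_graph) (simp add: length_rotation)
  then show ?thesis
    using assms length_w rotation_nth[OF assms, of 0] rotation_nth[OF assms, of 1]
    by (simp add: inv_letter_def)
qed

lemma verts_\<Gamma>: "verts \<Gamma> = {..<n} \<times> UNIV"
  by (simp add: star_graph_def cyclic_presentation_def)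

text \<open>The flip of a positive word starts with an inverse letter, so each edge contains only
  one positive word.\<close>

lemma edge_eq_imp_rotation_eq:
  assumes "edge j i = edge j' i'"
  shows "rotation j i = rotation j' i'"
proof -
  have "rotation j i \<noteq> flip_word (rotation j' i')"
  proof -
    have "2 \<le> length (rotation j' i')" using length_w by (simp add: length_rotation)
    then obtain x y u where r: "rotation j' i' = x # inv_letter y # u"
      by (rule length_two_cases)
    then have "\<not> positive (flip_word (rotation j' i'))"
      using rotation_positive[of j' i'] by (auto simp: flip_word_Cons positive_def inv_letter_def)
    then show ?thesis using rotation_positive by metis
  qed
  moreover have "rotation j i \<in> edge j' i'"
    unfolding assms [symmetric] by (simp add: edge_def)
  ultimately show ?thesis
    by (simp add: edge_def)
qed

lemma shift_eq_iff:
  assumes "j < n" "j' < n" "(shift n ^^ j) w = (shift n ^^ j') w"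
  shows "j = j'"
proof -
  have "rotation j 0 ! 0 = rotation j' 0 ! 0"
    using assms by (simp add: rotation_def)
  then have "(subscript 0 + j) mod n = (subscript 0 + j') mod n"
    using rotation_nth[OF k_pos k_pos] by simp
  then have "j mod n = j' mod n"
    by (simp add: nat_mod_eq_iff)
  with assms show ?thesis by simp
qed

text \<open>If \<open>i < i'\<close>, rotating back exhibits one relator as a rotation, hence a
  conjugate, of the other. Non-redundancy makes them equal, so \<open>j = j'\<close>, and then a
  nontrivial rotation fixes \<open>w\<close>, which must be a proper power.\<close>

lemma rotation_inj:
  assumes "non_redundant P" "\<not> proper_power {..<n} w"
    and "j < n" "j' < n" "i < k" "i' < k" "rotation j i = rotation j' i'"
  shows "i = i'"
proof -
  have *: False if eq: "rotation j i = rotation j' i'"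
    and ji: "j < n" "j' < n" "i < k" "i' < k" "i < i'" for i i' j j'
  proof -
    let ?r = "(shift n ^^ j) w" and ?r' = "(shift n ^^ j') w"
    have eq': "rotate i' ?r' = rotate i ?r"
      using eq by (simp add: rotation_def)
    \<comment> \<open>Rotating by \<open>k - i'\<close> undoes the rotation by \<open>i'\<close>.
      The total amount \<open>k - i' + i\<close> lies strictly between \<open>0\<close> and
      \<open>k\<close>.\<close>
    have "?r' = rotate (k - i') (rotate i' ?r')"
      using ji length_shift[of j'] by (simp add: rotate_rotate)
    also have "\<dots> = rotate (k - i' + i) ?r"
      unfolding eq' rotate_rotate ..
    finally have r': "?r' = rotate (k - i' + i) ?r" .
    have "?r = ?r'"
    proof (rule ccontr)
      assume ne: "?r \<noteq> ?r'"
      then have "\<not> free_eq ?r ?r'"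
        using free_eq_positive shift_positive by metis
      moreover have "freely_conjugate (gens P) ?r ?r'"
        using freely_conjugate_rotate[of ?r "gens P" "k - i' + i"] shift_words r'
        by (simp add: cyclic_presentation_def)
      ultimately have "freely_redundant P ?r"
        unfolding freely_redundant_def using ji(2) by (auto simp: rels_P)
      then show False
        using assms(1) ji(1) by (auto simp: non_redundant_def rels_P)
    qed
    then have "j = j'"
      using shift_eq_iff ji by blast
    then have "map (\<lambda>(i, e). ((i + j) mod n, e)) w = map (\<lambda>(i, e). ((i + j) mod n, e)) (rotate (k - i' + i) w)"
      using r' by (simp add: shift_funpow[OF w_words] rotate_map)
    \<comment> \<open>Shifting is injective on letters with subscripts below \<open>n\<close>, so it
      can be stripped from the equation between the shifted words.\<close>
    moreover have "inj_on (\<lambda>(i, e). ((i + j) mod n, e)) (set w \<union> set (rotate (k - i' + i) w))"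
    proof (rule inj_onI)
      fix x y assume xy: "x \<in> set w \<union> set (rotate (k - i' + i) w)" "y \<in> set w \<union> set (rotate (k - i' + i) w)"
        "(case x of (i, e) \<Rightarrow> ((i + j) mod n, e)) = (case y of (i, e) \<Rightarrow> ((i + j) mod n, e))"
      then have "fst x < n" "fst y < n"
        using w_words by (auto simp: words_def in_lists_conv_set)
      moreover have "fst x mod n = fst y mod n" "snd x = snd y"
        using xy(3) by (auto simp: split_def nat_mod_eq_iff)
      ultimately show "x = y" by (simp add: prod_eq_iff)
    qed
    ultimately have "w = rotate (k - i' + i) w"
      by (rule map_inj_on)
    then have "proper_power {..<n} w"
      using ji by (intro proper_power_rotate[OF w_words, of "k - i' + i"]) auto
    with assms(2) show False ..
  qed
  show ?thesis
    using *[of j i j' i'] *[of j' i' j i] assms by (metis nat_neq_iff)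
qed

section \<open>Steps between cyclically adjacent subscripts\<close>

lemma step_less: "step i < n"
  using n_pos by (simp add: step_def nat_less_iff)

lemma int_step: "int (step i) = (int (subscript (Suc i mod k)) - int (subscript i)) mod int n"
  using n_pos by (simp add: step_def)

lemma subscript_step:
  assumes "i < k"
  shows "(subscript i + step i) mod n = subscript (Suc i mod k)"
proof -
  have "int ((subscript i + step i) mod n) = int (subscript (Suc i mod k)) mod int n"
    by (simp add: int_step zmod_int mod_simps)
  then show ?thesis
    using subscript_less[of "Suc i mod k"] k_pos by (simp flip: zmod_int)
qed

lemma ends_edge_step:
  assumes "i < k" "(subscript i + j) mod n = c"
  shows "ends \<Gamma> (edge j i) = {(c, True), ((c + step i) mod n, False)}"
proof -
  have "(c + step i) mod n = ((subscript i + step i) mod n + j) mod n"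
    unfolding assms(2) [symmetric] by (simp add: mod_simps add_ac)
  then show ?thesis
    using ends_edge[OF assms(1), of j] assms subscript_step[OF assms(1)] by simp
qed

lemma edge_at:
  assumes "i < k" "c < n"
  obtains j where "j < n" "ends \<Gamma> (edge j i) = {(c, True), ((c + step i) mod n, False)}"
proof
  \<comment> \<open>This is \<open>c - subscript i\<close> modulo \<open>n\<close>, arranged to
    avoid truncated subtraction.\<close>
  let ?j = "(c + (n - subscript i)) mod n"
  show "?j < n" using n_pos by simp
  have "(subscript i + ?j) mod n = c"
    using subscript_less[OF assms(1)] assms(2) by (simp add: mod_simps)
  then show "ends \<Gamma> (edge ?j i) = {(c, True), ((c + step i) mod n, False)}"
    by (rule ends_edge_step[OF assms(1)])
qed

lemma edge_cases:
  assumes "e \<in> edges \<Gamma>"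
  obtains c i where "c < n" "i < k" "ends \<Gamma> e = {(c, True), ((c + step i) mod n, False)}"
proof -
  obtain j i where "i < k" "e = edge j i"
    using assms unfolding edges_\<Gamma> by auto
  then show ?thesis
    using ends_edge_step[of i j] n_pos by (intro that[of "(subscript i + j) mod n" i]) simp_all
qed

lemma ends_subset_verts: "e \<in> edges \<Gamma> \<Longrightarrow> ends \<Gamma> e \<subseteq> verts \<Gamma>"
  by (elim edge_cases) (use n_pos in \<open>simp add: verts_\<Gamma>\<close>)

text \<open>The differences telescope around the cyclic word, since the cyclic successor only
  permutes the positions.\<close>

lemma dvd_sum_step: "int n dvd (\<Sum>i<k. int (step i))"
proof -
  have "(\<Sum>i<k. int (subscript (Suc i mod k))) = (\<Sum>i<k. int (subscript i))"
  proof -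
    obtain m where k: "k = Suc m" using k_pos gr0_implies_Suc by blast
    show ?thesis
      unfolding k by (subst sum.lessThan_Suc, subst sum.lessThan_Suc_shift) simp
  qed
  then have "(\<Sum>i<k. int (subscript (Suc i mod k)) - int (subscript i)) mod int n = 0"
    by (simp add: sum_subtractf)
  then have "(\<Sum>i<k. int (step i)) mod int n = 0"
    unfolding int_step by (simp add: mod_sum_eq)
  then show ?thesis by (simp add: dvd_eq_mod_eq_0)
qed

lemma subscripts_eq: "subscripts w = subscript ` {..<k}"
  unfolding subscripts_def set_conv_nth by (auto simp: subscript_def)

text \<open>From a position with subscript \<open>0\<close>, steps divisible by \<open>g\<close>
  lead around the word through subscripts divisible by \<open>g\<close>; so \<open>g\<close> divides
  the gcd that irreducibility makes \<open>1\<close>.\<close>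

lemma common_divisor_of_steps:
  assumes "irreducible_cyclic n w" "0 \<in> subscripts w"
    and "g dvd n" "\<And>i. i < k \<Longrightarrow> g dvd step i"
  shows "g = 1"
proof -
  obtain i0 where i0: "i0 < k" "subscript i0 = 0"
    using assms(2) unfolding subscripts_eq by auto
  have "g dvd subscript ((i0 + m) mod k)" for m
  proof (induction m)
    case (Suc m)
    let ?i = "(i0 + m) mod k"
    have i: "?i < k" by simp
    have "g dvd (subscript ?i + step ?i) mod n"
      using Suc.IH assms(4)[OF i] assms(3) by (simp add: dvd_mod)
    moreover have "Suc ?i mod k = (i0 + Suc m) mod k"
      by (simp add: mod_Suc_eq)
    ultimately show ?case
      using subscript_step[OF i] by simp
  qed (use i0 in simp)
  moreover have "i = (i0 + (i + (k - i0))) mod k" if "i < k" for i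
    using that i0 by simp
  ultimately have "g dvd subscript i" if "i < k" for i
    using that by metis
  then have "g dvd Gcd (insert n (subscripts w))"
    using assms(3) by (intro Gcd_greatest) (auto simp: subscripts_eq)
  then have "g dvd 1"
    using assms(1) by (simp only: irreducible_cyclic_def)
  then show ?thesis by simp
qed

section \<open>Consequences of special graph invariants for the steps\<close>

definition base_component :: "(nat letter, nat word set) multigraph" where
  "base_component = induced_subgraph \<Gamma> {u. reachable \<Gamma> (0, True) u}"

lemma base_component_in: "base_component \<in> components \<Gamma>"
  unfolding components_def base_component_def
  by (rule image_eqI[of _ _ "(0, True)"]) (use n_pos in \<open>simp_all add: verts_\<Gamma>\<close>)

lemma verts_base_component: "v \<in> verts base_component \<longleftrightarrow> reachable \<Gamma> (0, True) v"
  by (simp add: base_component_def induced_subgraph_def)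

lemma zero_in_base_component: "(0, True) \<in> verts base_component"
  using n_pos by (simp add: verts_base_component reachable_refl verts_\<Gamma>)

lemma ends_base_component: "ends base_component = ends \<Gamma>"
  by (simp add: base_component_def induced_subgraph_def)

lemma edge_base_component:
  assumes "e \<in> edges \<Gamma>" "ends \<Gamma> e = {u, v}" "u \<in> verts base_component"
  shows "e \<in> edges base_component" "v \<in> verts base_component"
proof -
  have "v \<in> verts \<Gamma>"
    using ends_subset_verts[OF assms(1)] assms(2) by simp
  then show v: "v \<in> verts base_component"
    using assms reachable_edge unfolding verts_base_component by metis
  show "e \<in> edges base_component"
    using v assms unfolding verts_base_component by (simp add: base_component_def induced_subgraph_def)
qed

text \<open>Equal steps at two positions would give two distinct edges from \<open>(0, True)\<close>
  to the same inverse letter, a closed path of length two.\<close>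

lemma step_inj:
  assumes "girth base_component = 4" "non_redundant P" "\<not> proper_power {..<n} w"
  shows "inj_on step {..<k}"
proof (rule inj_onI, rule ccontr)
  fix i i' assume ii: "i \<in> {..<k}" "i' \<in> {..<k}" "step i = step i'" "i \<noteq> i'"
  then have i: "i < k" "i' < k" by simp_all
  obtain j where j: "j < n" "ends \<Gamma> (edge j i) = {(0, True), ((0 + step i) mod n, False)}"
    by (rule edge_at[OF i(1) n_pos])
  obtain j' where j': "j' < n" "ends \<Gamma> (edge j' i') = {(0, True), ((0 + step i') mod n, False)}"
    by (rule edge_at[OF i(2) n_pos])
  let ?v = "(step i, False)" and ?C = base_component
  have e: "edge j i \<in> edges \<Gamma>" "ends \<Gamma> (edge j i) = {(0, True), ?v}"
    using j edge_in_edges i step_less by simp_all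
  have f: "edge j' i' \<in> edges \<Gamma>" "ends \<Gamma> (edge j' i') = {(0, True), ?v}"
    using j' edge_in_edges i ii(3) step_less by simp_all
  have ne: "edge j i \<noteq> edge j' i'"
  proof
    assume "edge j i = edge j' i'"
    then have "rotation j i = rotation j' i'"
      by (rule edge_eq_imp_rotation_eq)
    then have "i = i'"
      by (rule rotation_inj[OF assms(2,3) j(1) j'(1) i])
    with ii(4) show False ..
  qed
  note eC = edge_base_component[OF e zero_in_base_component]
    and fC = edge_base_component[OF f zero_in_base_component]
  have f': "ends ?C (edge j' i') = {?v, (0, True)}" and e': "ends ?C (edge j i) = {(0, True), ?v}"
    unfolding ends_base_component f(2) e(2) by (rule insert_commute, rule refl)
  have "walk ?C ?v [edge j' i'] (0, True)"
    by (rule walk_ConsI[OF fC(1) f' fC(2)]) (simp add: zero_in_base_component)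
  then have "walk ?C (0, True) [edge j i, edge j' i'] (0, True)"
    by (rule walk_ConsI[OF eC(1) e' zero_in_base_component])
  then have "girth ?C \<le> enat (length [edge j i, edge j' i'])"
    unfolding girth_def using ne
    by (intro Inf_lower CollectI exI[of _ "(0, True)"] exI[of _ "[edge j i, edge j' i']"]) (simp del: walk.simps(2))
  then show False
    using assms(1) by (simp add: numeral_eq_enat)
qed

text \<open>The end point of a walk of three edges is at odd distance, hence at distance one, from its
  start.\<close>

lemma step_affine_closed:
  assumes "diameter base_component = 2" and hil: "h < k" "i < k" "l < k"
  shows "\<exists>m<k. int (step m) = (int (step h) - int (step i) + int (step l)) mod int n"
proof -
  let ?C = base_component
  \<comment> \<open>The walk leads from \<open>0\<close> forward by \<open>step h\<close>, back by
    \<open>step i\<close> to \<open>c\<close>, and forward by \<open>step l\<close> to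
    \<open>x\<close>.\<close>
  define c where "c = (step h + (n - step i)) mod n"
  define x where "x = (c + step l) mod n"
  have c: "c < n" "(c + step i) mod n = step h"
    using n_pos step_less[of i] step_less[of h] by (simp_all add: c_def mod_simps)
  obtain j1 where j1: "j1 < n" "ends \<Gamma> (edge j1 h) = {(0, True), ((0 + step h) mod n, False)}"
    by (rule edge_at[OF hil(1) n_pos])
  obtain j2 where j2: "j2 < n" "ends \<Gamma> (edge j2 i) = {(c, True), (step h, False)}"
    using edge_at[OF hil(2) c(1)] unfolding c(2) .
  obtain j3 where j3: "j3 < n" "ends \<Gamma> (edge j3 l) = {(c, True), (x, False)}"
    unfolding x_def by (rule edge_at[OF hil(3) c(1)])
  have "((0 + step h) mod n, False) \<in> verts ?C"
    by (rule edge_base_component(2)[OF edge_in_edges[OF j1(1) hil(1)] j1(2) zero_in_base_component])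
  then have "(step h, False) \<in> verts ?C"
    using step_less by simp
  then have "(c, True) \<in> verts ?C"
    by (rule edge_base_component(2)[OF edge_in_edges[OF j2(1) hil(2)] j2(2)[unfolded insert_commute[of "(c, True)"]]])
  then have "(x, False) \<in> verts ?C"
    by (rule edge_base_component(2)[OF edge_in_edges[OF j3(1) hil(3)] j3(2)])
  then have "distance ?C (0, True) (x, False) \<le> enat 2"
    using distance_le_diameter[OF zero_in_base_component] assms(1) by (simp add: numeral_eq_enat)
  then obtain es where es: "walk ?C (0, True) es (x, False)" "length es \<le> 2"
    by (rule short_walk)
  have edges_C: "e \<in> edges \<Gamma>" if "e \<in> edges ?C" for e
    using that by (simp add: base_component_def induced_subgraph_def)
  \<comment> \<open>Every edge joins a generator to an inverse generator, so the sign of the end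
    letters determines the parity of the length.\<close>
  have "((0 :: nat, True) \<in> {v. snd v} \<longleftrightarrow> (x, False) \<in> {v. snd v}) \<longleftrightarrow> even (length es)"
    using es(1)
  proof (rule walk_parity)
    fix e assume "e \<in> edges ?C"
    then obtain c i where "ends \<Gamma> e = {(c, True), ((c + step i) mod n, False)}"
      using edge_cases[OF edges_C] by metis
    then show "\<exists>x\<in>{v. snd v}. \<exists>y. y \<notin> {v. snd v} \<and> ends ?C e = {x, y}"
      unfolding ends_base_component
      by (intro bexI[of _ "(c, True)"] exI[of _ "((c + step i) mod n, False)"]) simp_all
  qed
  then have "odd (length es)" by simp
  then have "length es = 1" using es(2) by presburger
  then obtain e where "es = [e]" by (auto simp: length_Suc_conv)
  from es(1) obtain y where "e \<in> edges ?C" "ends ?C e = {(0, True), y}" "walk ?C y [] (x, False)"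
    unfolding \<open>es = [e]\<close> walk.simps(2) by blast
  then have e: "e \<in> edges ?C" "ends \<Gamma> e = {(0, True), (x, False)}"
    by (simp_all add: ends_base_component)
  obtain c' m where m: "m < k" "ends \<Gamma> e = {(c', True), ((c' + step m) mod n, False)}"
    by (rule edge_cases[OF edges_C[OF e(1)]])
  then have "{(0, True), (x, False)} = {(c', True), ((c' + step m) mod n, False)}"
    using e(2) by (simp only:)
  then have "c' = 0" "x = (c' + step m) mod n"
    unfolding doubleton_eq_iff by simp_all
  then have "x = step m" using step_less by simp
  moreover have "int x = (int (step h) - int (step i) + int (step l)) mod int n"
  proof -
    have "int x = (int (step h) - int (step i) + int (step l) + int n) mod int n"
      using step_less[of i] unfolding x_def c_def
      by (simp add: zmod_int of_nat_diff mod_simps algebra_simps del: mod_add_self1 mod_add_self2)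
    then show ?thesis by (simp only: mod_add_self2)
  qed
  ultimately show ?thesis using m(1) by auto
qed

text \<open>One component reveals all steps, as each of them occurs on an edge at
  \<open>(0, True)\<close>. Its girth makes them distinct, its diameter makes them an affine set,
  and the vanishing of their sum modulo \<open>n\<close> selects \<open>d\<close>.\<close>

lemma special_imp_steps:
  assumes special: "special 2 k \<nu> P" and nr: "non_redundant P" and npp: "\<not> proper_power {..<n} w"
    and irr: "irreducible_cyclic n w" and zero: "0 \<in> subscripts w"
  obtains d where "d = 1 \<and> odd k \<or> d = 2 \<and> even k" "n = d * k"
    "inj_on step {..<k}" "step ` {..<k} = {q. q < n \<and> d dvd Suc q}"
proof -
  have "diameter base_component = enat 2" "girth base_component = enat (2 * 2)"
    using special base_component_in unfolding special_def by blast+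
  then have diam: "diameter base_component = 2" and girth: "girth base_component = 4"
    by (simp_all add: numeral_eq_enat)
  have inj: "inj_on step {..<k}"
    using step_inj[OF girth nr npp] .
  define S where "S = (\<lambda>i. int (step i)) ` {..<k}"
  have "0 < int n" using n_pos by simp
  then obtain d r where d: "0 < d" "d dvd int n" "0 \<le> r" "r < d" and S: "S = {x \<in> {0..<int n}. x mod d = r}"
  proof (rule affine_closed_residues[of "int n" S])
    show "S \<subseteq> {0..<int n}" using step_less by (auto simp: S_def)
    show "S \<noteq> {}" by (simp add: S_def lessThan_empty_iff)
    fix a b c assume "a \<in> S" "b \<in> S" "c \<in> S"
    then obtain h i l where "h < k" "i < k" "l < k" "a = int (step h)" "b = int (step i)" "c = int (step l)"
      by (auto simp: S_def)
    then show "(a - b + c) mod int n \<in> S"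
      using step_affine_closed[OF diam, of h i l] unfolding S_def by (metis image_eqI lessThan_iff)
  qed blast
  obtain k' where k': "int n = d * k'" using d(2) by (elim dvdE)
  then have "0 \<le> k'" using d(1) n_pos by (smt (verit) mult_le_0_iff of_nat_0_less_iff)
  then have nk': "int n = d * int (nat k')" using k' by simp
  have S': "S = (\<lambda>j. r + d * int j) ` {..<nat k'}"
    unfolding S nk' by (rule residue_class_eq_image[OF d(1,3,4)])
  have inj': "inj_on (\<lambda>j. r + d * int j) {..<nat k'}"
    using d(1) by (auto simp: inj_on_def)
  have inj_S: "inj_on (\<lambda>i. int (step i)) {..<k}"
    using inj by (auto simp: inj_on_def)
  \<comment> \<open>Counting \<open>S\<close> by positions and by residues identifies the quotient
    \<open>k'\<close> of \<open>n\<close> by \<open>d\<close> with \<open>k\<close>.\<close>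
  have "card S = k"
    unfolding S_def by (simp add: card_image[OF inj_S])
  then have "nat k' = k"
    unfolding S' by (simp add: card_image[OF inj'])
  with nk' S' inj' have n: "int n = d * int k" and S': "S = (\<lambda>j. r + d * int j) ` {..<k}"
      and inj': "inj_on (\<lambda>j. r + d * int j) {..<k}"
    by simp_all
  have "(\<Sum>j<k. r + d * int j) = \<Sum> S"
    unfolding S' by (simp add: sum.reindex[OF inj'])
  also have "\<dots> = (\<Sum>i<k. int (step i))"
    unfolding S_def by (simp add: sum.reindex[OF inj_S])
  finally have dvd: "d * int k dvd (\<Sum>j<k. r + d * int j)"
    using dvd_sum_step n by simp
  \<comment> \<open>This gcd divides \<open>n\<close> and, since each step is \<open>r\<close>
    modulo \<open>d\<close>, every step.\<close>
  have "gcd d r = 1"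
  proof -
    let ?g = "nat (gcd d r)"
    have "int ?g dvd int (step i)" if "i < k" for i
    proof -
      have "int (step i) \<in> S" using that by (auto simp: S_def)
      then have "int (step i) mod d = r" by (simp add: S)
      then have "int (step i) = d * (int (step i) div d) + r" by (metis mult_div_mod_eq)
      then show ?thesis by (metis dvd_add dvd_mult2 gcd_dvd1 gcd_dvd2 gcd_ge_0_int int_nat_eq)
    qed
    moreover have "int ?g dvd int n"
      using d(2) by (simp add: gcd_dvdI1)
    ultimately have "?g = 1"
      by (intro common_divisor_of_steps[OF irr zero]) (simp_all only: int_dvd_int_iff)
    then show ?thesis by simp
  qed
  with arith_sum_dvd_cases[OF d(1,3,4) k_pos _ dvd]
  have cases: "(d = 1 \<and> r = 0 \<and> odd k) \<or> (d = 2 \<and> r = 1 \<and> even k)" by simp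
  have "step ` {..<k} = {q. q < n \<and> nat d dvd Suc q}"
  proof -
    \<comment> \<open>Both cases have \<open>r = d - 1\<close>, so one formula covers them.\<close>
    have "int q mod d = r \<longleftrightarrow> nat d dvd Suc q" for q
      using cases by (elim disjE) (auto, presburger+)
    then have "int q \<in> S \<longleftrightarrow> q < n \<and> nat d dvd Suc q" for q
      by (auto simp: S)
    moreover have "int q \<in> S \<longleftrightarrow> q \<in> step ` {..<k}" for q
      by (auto simp: S_def)
    ultimately show ?thesis by auto
  qed
  moreover have "n = nat d * k"
    using n d(1) by (metis int_nat_eq nat_int nat_mult_distrib order_less_imp_le)
  ultimately show ?thesis
    using cases inj by (intro that[of "nat d"]) auto
qed

section \<open>The star graph when the steps form the class of \<open>-1\<close> modulo
  \<open>d\<close>\<close>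

context
  fixes d :: nat
  assumes d_pos: "0 < d" and n_eq: "n = d * k" and k_ge: "3 \<le> k"
    and step_inj_on: "inj_on step {..<k}"
    and step_image: "step ` {..<k} = {q. q < n \<and> d dvd Suc q}"
begin

text \<open>Since every step is \<open>-1\<close> modulo \<open>d\<close>, an edge from \<open>x\<^sub>c\<close> to the inverse of \<open>x\<^sub>e\<close> forces
  \<open>e + 1 = c\<close> modulo \<open>d\<close>; the colour therefore labels the connected components.\<close>

definition color :: "nat letter \<Rightarrow> nat" where
  "color v = (if snd v then fst v else Suc (fst v)) mod d"

definition side :: "bool \<Rightarrow> nat \<Rightarrow> nat letter set" where
  "side b s = {v \<in> verts \<Gamma>. snd v = b \<and> color v = s}"

lemma d_dvd_n: "d dvd n"
  by (simp add: n_eq)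

lemma color_step:
  assumes "i < k"
  shows "color ((c + step i) mod n, False) = color (c, True)"
proof -
  have "step i \<in> {q. q < n \<and> d dvd Suc q}"
    unfolding step_image [symmetric] using assms by simp
  then obtain m where "Suc (step i) = d * m" by (auto elim: dvdE)
  then have "Suc (c + step i) = c + d * m" by simp
  then have "Suc (c + step i) mod d = c mod d" by (simp only: mod_mult_self2)
  moreover have "Suc ((c + step i) mod n) mod d = Suc (c + step i) mod d"
    by (metis d_dvd_n mod_Suc_eq mod_mod_cancel)
  ultimately show ?thesis by (simp only: color_def fst_conv snd_conv if_True if_False)
qed

text \<open>Edges preserve the colour. Conversely, for letters \<open>(c, True)\<close> and
  \<open>(c', False)\<close> of one colour, \<open>c' - c\<close> is \<open>-1\<close> modulo
  \<open>d\<close>, hence a step, and so an edge joins them.\<close>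

lemma ends_\<Gamma>_eq: "ends \<Gamma> ` edges \<Gamma> = (\<Union>s<d. doubletons (side True s) (side False s))"
proof (intro subset_antisym subsetI)
  fix S assume "S \<in> ends \<Gamma> ` edges \<Gamma>"
  then obtain e where e: "e \<in> edges \<Gamma>" "S = ends \<Gamma> e" by blast
  obtain c i where ci: "c < n" "i < k" "ends \<Gamma> e = {(c, True), ((c + step i) mod n, False)}"
    using e(1) by (rule edge_cases)
  have "(c, True) \<in> side True (color (c, True))"
    using ci by (simp add: side_def verts_\<Gamma>)
  moreover have "((c + step i) mod n, False) \<in> side False (color (c, True))"
    using ci color_step[OF ci(2)] n_pos by (simp add: side_def verts_\<Gamma>)
  ultimately have "S \<in> doubletons (side True (color (c, True))) (side False (color (c, True)))"
    unfolding e(2) ci(3) by (rule doubletonsI)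
  moreover have "color (c, True) < d" using d_pos by (simp add: color_def)
  ultimately show "S \<in> (\<Union>s<d. doubletons (side True s) (side False s))" by blast
next
  fix S assume "S \<in> (\<Union>s<d. doubletons (side True s) (side False s))"
  then obtain s where "S \<in> doubletons (side True s) (side False s)" by blast
  then obtain u v where uv: "u \<in> side True s" "v \<in> side False s" "S = {u, v}"
    by (rule doubletonsE)
  obtain c c' where c: "u = (c, True)" "c < n" "v = (c', False)" "c' < n" "c mod d = Suc c' mod d"
    using uv(1,2) by (cases u; cases v) (auto simp: side_def verts_\<Gamma> color_def)
  \<comment> \<open>The residue \<open>c' - c\<close>, the step that an edge between the two letters
    must have.\<close>
  define q where "q = (c' + (n - c)) mod n"
  let ?x = "Suc (c' + (n - c))"
  have "?x + c = Suc c' + d * k"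
    using c(2) by (simp flip: n_eq)
  then have "(?x + c) mod d = c mod d"
    by (simp only: mod_mult_self2 c(5))
  then have "d dvd ?x"
    using mod_eq_dvd_iff_nat[of c "?x + c" d] by simp
  moreover have "Suc q mod d = ?x mod d"
    unfolding q_def by (metis d_dvd_n mod_Suc_eq mod_mod_cancel)
  ultimately have "d dvd Suc q"
    by (simp only: dvd_eq_mod_eq_0)
  then have "q \<in> step ` {..<k}"
    unfolding step_image using n_pos by (simp add: q_def)
  then obtain i where i: "i < k" "q = step i" by blast
  obtain j where j: "j < n" "ends \<Gamma> (edge j i) = {(c, True), ((c + step i) mod n, False)}"
    using i(1) c(2) by (rule edge_at)
  have "(c + step i) mod n = c'"
    using c unfolding i(2) [symmetric] q_def by (simp add: mod_simps)
  then have "S = ends \<Gamma> (edge j i)"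
    using j uv(3) c by simp
  then show "S \<in> ends \<Gamma> ` edges \<Gamma>"
    using edge_in_edges[OF j(1) i(1)] by (rule image_eqI)
qed

text \<open>The end points determine the step, injectivity of \<open>step\<close> recovers
  \<open>i\<close>, and the positive end point then recovers \<open>j\<close>.\<close>

lemma ends_\<Gamma>_inj: "inj_on (ends \<Gamma>) (edges \<Gamma>)"
proof (rule inj_onI)
  fix e f assume "e \<in> edges \<Gamma>" "f \<in> edges \<Gamma>" and eq: "ends \<Gamma> e = ends \<Gamma> f"
  obtain j i where e: "e = edge j i" "j < n" "i < k"
    using \<open>e \<in> edges \<Gamma>\<close> unfolding edges_\<Gamma> by auto
  obtain j' i' where f: "f = edge j' i'" "j' < n" "i' < k"
    using \<open>f \<in> edges \<Gamma>\<close> unfolding edges_\<Gamma> by auto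
  let ?c = "(subscript i + j) mod n" and ?c' = "(subscript i' + j') mod n"
  have "{(?c, True), ((?c + step i) mod n, False)} = {(?c', True), ((?c' + step i') mod n, False)}"
    using eq unfolding e(1) f(1) ends_edge_step[OF e(3) refl] ends_edge_step[OF f(3) refl] .
  then have "?c = ?c' \<and> (?c + step i) mod n = (?c' + step i') mod n"
    unfolding doubleton_eq_iff by (auto simp only: prod.inject)
  then have c: "?c = ?c'" and c2: "(?c + step i) mod n = (?c' + step i') mod n"
    by blast+
  have "(?c + step i) mod n = (?c + step i') mod n"
    using c2 unfolding c .
  then have "step i mod n = step i' mod n" by (simp only: nat_mod_eq_iff) simp
  then have "step i = step i'" using step_less by simp
  then have i: "i = i'" using step_inj_on e(3) f(3) by (auto dest: inj_onD)
  with c have "j mod n = j' mod n" by (simp only: nat_mod_eq_iff) simp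
  with i e f show "e = f" by simp
qed

lemma color_less: "color v < d"
  using d_pos by (simp add: color_def)

lemma verts_color: "{u \<in> verts \<Gamma>. color u = s} = side True s \<union> side False s"
  by (auto simp: side_def)

lemma sides_disjoint: "side True s \<inter> side False s' = {}"
  by (auto simp: side_def)

lemma card_side:
  assumes "s < d"
  shows "card (side b s) = k" "finite (side b s)"
proof -
  \<comment> \<open>The residue of the subscripts on this side; for inverse letters it is one less
    than the colour, cyclically.\<close>
  define t where "t = (if b then s else if s = 0 then d - 1 else s - 1)"
  have t: "t < d" using assms by (auto simp: t_def)
  have color: "color (c, b) = s \<longleftrightarrow> c mod d = t" for c
    by (cases b) (simp_all only: color_def t_def fst_conv snd_conv if_True if_False Suc_mod_eq_iff[OF assms])
  have "side b s = (\<lambda>c. (c, b)) ` {c. c < n \<and> color (c, b) = s}"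
    by (auto simp: side_def verts_\<Gamma>)
  then have "side b s = (\<lambda>c. (c, b)) ` {c. c < n \<and> c mod d = t}"
    by (simp only: color)
  moreover have "inj_on (\<lambda>c. (c, b)) {c. c < n \<and> c mod d = t}"
    by (auto simp: inj_on_def)
  ultimately show "card (side b s) = k" "finite (side b s)"
    using card_residue_class[OF t, of k, folded n_eq] by (simp_all add: card_image)
qed

lemma color_ends:
  assumes "e \<in> edges \<Gamma>" "u \<in> ends \<Gamma> e" "v \<in> ends \<Gamma> e"
  shows "color u = color v"
proof -
  obtain c i where "c < n" "i < k" "ends \<Gamma> e = {(c, True), ((c + step i) mod n, False)}"
    using assms(1) by (rule edge_cases)
  then show ?thesis
    using assms(2,3) color_step by auto
qed

text \<open>The positive end point of an edge fixes its colour, so the edges inside one colour class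
  are exactly those contributed by that colour.\<close>

lemma biclique_side:
  assumes "s < d"
  shows "biclique (induced_subgraph \<Gamma> (side True s \<union> side False s)) (side True s) (side False s)"
proof -
  let ?C = "side True s \<union> side False s"
  have "ends \<Gamma> ` {e \<in> edges \<Gamma>. ends \<Gamma> e \<subseteq> ?C} = doubletons (side True s) (side False s)"
  proof (intro subset_antisym subsetI)
    fix S assume "S \<in> ends \<Gamma> ` {e \<in> edges \<Gamma>. ends \<Gamma> e \<subseteq> ?C}"
    then have "S \<in> ends \<Gamma> ` edges \<Gamma>" and sub: "S \<subseteq> ?C" by blast+
    then obtain s' where "S \<in> doubletons (side True s') (side False s')"
      unfolding ends_\<Gamma>_eq by blast
    then obtain u v where uv: "u \<in> side True s'" "v \<in> side False s'" "S = {u, v}"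
      by (rule doubletonsE)
    with sub have "u \<in> ?C" by simp
    with uv(1) have "s' = s" by (auto simp: side_def)
    with \<open>S \<in> doubletons (side True s') (side False s')\<close>
    show "S \<in> doubletons (side True s) (side False s)" by simp
  next
    fix S assume S: "S \<in> doubletons (side True s) (side False s)"
    then have "S \<in> ends \<Gamma> ` edges \<Gamma>"
      unfolding ends_\<Gamma>_eq using assms by blast
    then obtain e where e: "e \<in> edges \<Gamma>" "S = ends \<Gamma> e" by blast
    have "S \<subseteq> ?C" using S by (rule doubletonsE) simp
    with e show "S \<in> ends \<Gamma> ` {e \<in> edges \<Gamma>. ends \<Gamma> e \<subseteq> ?C}" by blast
  qed
  moreover have "inj_on (ends \<Gamma>) {e \<in> edges \<Gamma>. ends \<Gamma> e \<subseteq> ?C}"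
    by (rule inj_on_subset[OF ends_\<Gamma>_inj]) blast
  ultimately show ?thesis
    using sides_disjoint by (simp add: biclique_def induced_subgraph_def)
qed

lemma side_nonempty: "s < d \<Longrightarrow> side b s \<noteq> {}"
  using card_side[of s b] k_pos by force

lemma same_color_reachable:
  assumes "u \<in> verts \<Gamma>" "v \<in> verts \<Gamma>" "color u = color v"
  shows "reachable \<Gamma> u v"
proof -
  let ?s = "color u"
  let ?C = "side True ?s \<union> side False ?s"
  have "u \<in> verts (induced_subgraph \<Gamma> ?C)" "v \<in> verts (induced_subgraph \<Gamma> ?C)"
    using assms by (simp_all add: induced_subgraph_def flip: verts_color)
  then obtain es where "walk (induced_subgraph \<Gamma> ?C) u es v"
    using biclique_short_walk[OF biclique_side[OF color_less] side_nonempty[OF color_less] side_nonempty[OF color_less]]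
    by metis
  then have "walk \<Gamma> u es v"
    by (rule walk_induced_subgraph) (auto simp: side_def)
  then show ?thesis by (auto simp: reachable_def)
qed

lemma color_image: "color ` verts \<Gamma> = {..<d}"
proof (intro subset_antisym subsetI)
  fix s assume "s \<in> {..<d}"
  then obtain v where "v \<in> side True s" using side_nonempty by blast
  then show "s \<in> color ` verts \<Gamma>" by (auto simp: side_def)
qed (use color_less in auto)

lemma components_\<Gamma>: "components \<Gamma> = (\<lambda>s. induced_subgraph \<Gamma> (side True s \<union> side False s)) ` {..<d}"
  unfolding verts_color [symmetric] color_image [symmetric]
  by (rule components_eq(1)) (rule color_ends same_color_reachable; assumption)+

lemma card_components_\<Gamma>: "card (components \<Gamma>) = d"
proof -
  have "card (components \<Gamma>) = card (color ` verts \<Gamma>)"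
    by (rule components_eq(2)) (rule color_ends same_color_reachable; assumption)+
  then show ?thesis by (simp add: color_image)
qed

lemma two_in_side:
  assumes "s < d"
  obtains x y where "x \<in> side b s" "y \<in> side b s" "x \<noteq> y"
proof -
  have "\<not> card (side b s) \<le> Suc 0" using card_side(1)[OF assms, of b] k_ge by linarith
  then show ?thesis
    using that card_side(2)[OF assms, of b] by (meson card_le_Suc0_iff_eq)
qed

text \<open>Each component is a biclique with \<open>k\<close> vertices on either side, which yields
  diameter, girth and degrees; equal side sizes make the components isomorphic.\<close>

lemma steps_imp_special:
  assumes "4 \<le> k"
  shows "special 2 k d P"
proof -
  have comp: "connected_graph C \<and> bipartite C \<and> diameter C = enat 2 \<and> girth C = enat (2 * 2) \<and>
      (\<forall>v\<in>verts C. degree C v \<ge> 3)" if C: "C \<in> components \<Gamma>" for C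
  proof -
    obtain s where s: "s < d" and C_eq: "C = induced_subgraph \<Gamma> (side True s \<union> side False s)"
      using C unfolding components_\<Gamma> by blast
    have b: "biclique C (side True s) (side False s)"
      unfolding C_eq by (rule biclique_side[OF s])
    obtain x x' where x: "x \<in> side True s" "x' \<in> side True s" "x \<noteq> x'"
      using s by (rule two_in_side)
    obtain y y' where y: "y \<in> side False s" "y' \<in> side False s" "y \<noteq> y'"
      using s by (rule two_in_side)
    have "degree C v \<ge> 3" if "v \<in> verts C" for v
    proof (cases "v \<in> side True s")
      case True
      then show ?thesis
        using biclique_degree[OF b True] card_side(1)[OF s, of False] k_ge by simp
    next
      case False
      then have v: "v \<in> side False s" using that biclique_verts[OF b] by blast
      show ?thesis
        using biclique_degree[OF biclique_commute[THEN iffD1, OF b] v] card_side(1)[OF s, of True] k_ge by simp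
    qed
    moreover have "diameter C = 2"
      by (rule biclique_diameter[OF b side_nonempty[OF s] x])
    moreover have "girth C = 4"
      by (rule biclique_girth[OF b x y])
    ultimately show ?thesis
      using biclique_connected[OF b side_nonempty[OF s] side_nonempty[OF s]] biclique_bipartite[OF b]
      by (simp add: numeral_eq_enat)
  qed
  have iso: "graph_iso C D" if CD: "C \<in> components \<Gamma>" "D \<in> components \<Gamma>" for C D
  proof -
    obtain s t where st: "s < d" "t < d" "C = induced_subgraph \<Gamma> (side True s \<union> side False s)"
        "D = induced_subgraph \<Gamma> (side True t \<union> side False t)"
      using CD unfolding components_\<Gamma> by blast
    show ?thesis
      unfolding st(3,4)
      by (rule biclique_graph_iso[OF biclique_side[OF st(1)] biclique_side[OF st(2)]])
        (simp_all add: card_side st(1,2))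
  qed
  have rels: "r \<in> words {..<n} \<and> cyclically_reduced r \<and> length r = k" if "r \<in> rels P" for r
    using that shift_words length_shift cyclically_reduced_positive[OF shift_positive]
    by (auto simp: rels_P)
  have "finite (gens P)" "finite (rels P)" "gens P = {..<n}"
    by (simp_all add: cyclic_presentation_def)
  then show ?thesis
    unfolding special_def using assms d_pos card_components_\<Gamma> comp iso rels
    by (intro conjI ballI impI subsetI) auto
qed

lemma graph_iso_complete_bipartite:
  assumes "d = 1"
  shows "graph_iso \<Gamma> (complete_bipartite n n)"
proof -
  have nk: "n = k" using assms n_eq by simp
  have "biclique \<Gamma> (side True 0) (side False 0)"
    unfolding biclique_def
  proof (intro conjI)
    show "verts \<Gamma> = side True 0 \<union> side False 0"
      unfolding verts_color [symmetric] using assms color_less by auto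
    have "{..<d} = {0}" using assms by auto
    then show "ends \<Gamma> ` edges \<Gamma> = doubletons (side True 0) (side False 0)"
      unfolding ends_\<Gamma>_eq by simp
  qed (rule sides_disjoint ends_\<Gamma>_inj)+
  then have "graph_iso \<Gamma> (complete_bipartite k k)"
    by (rule biclique_graph_iso[OF _ biclique_complete_bipartite])
      (simp_all add: card_side d_pos card_image)
  then show ?thesis unfolding nk [symmetric] .
qed

lemma graph_iso_two_complete_bipartite:
  assumes "d = 2"
  shows "graph_iso \<Gamma> (disjoint_union (complete_bipartite k k) (complete_bipartite k k))"
proof -
  have d: "0 < d" "1 < d" using assms by simp_all
  have "graph_iso \<Gamma> (disjoint_union
      (complete_bipartite (card (side True 0)) (card (side False 0)))
      (complete_bipartite (card (side True 1)) (card (side False 1))))"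
  proof (rule graph_iso_two_bicliques[OF ends_\<Gamma>_inj])
    show "verts \<Gamma> = side True 0 \<union> side False 0 \<union> (side True 1 \<union> side False 1)"
      unfolding verts_color [symmetric] using color_less assms less_2_cases by auto
    show "(side True 0 \<union> side False 0) \<inter> (side True 1 \<union> side False 1) = {}"
      by (auto simp: side_def)
    have "{..<d} = {0, 1}" using assms by auto
    then show "ends \<Gamma> ` edges \<Gamma> = doubletons (side True 0) (side False 0) \<union> doubletons (side True 1) (side False 1)"
      unfolding ends_\<Gamma>_eq by simp
  qed (simp_all add: sides_disjoint card_side d del: One_nat_def)
  then show ?thesis
    using card_side(1)[OF d(1)] card_side(1)[OF d(2)] by simp
qed

end

end

theorem theorem3:
  fixes n k \<nu> :: nat and w :: "nat word"
  assumes "n \<ge> 1" and "\<nu> \<ge> 1"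
    and "w \<in> words {..<n}" and "cyclically_reduced w" and "0 \<in> subscripts w"
    and "positive w" and "length w = k"
    and "\<not> proper_power {..<n} w"
    and "irreducible_cyclic n w"
    and "non_redundant (cyclic_presentation n w)"
  defines "Q \<equiv> step_multiset n w"
    and "\<Gamma> \<equiv> star_graph (cyclic_presentation n w)"
  defines "case_a \<equiv> k \<ge> 5 \<and> odd k \<and> n = k \<and> \<nu> = 1 \<and> Q = mset_set {0..n - 1}"
    and "case_b \<equiv> k \<ge> 4 \<and> even k \<and> n = 2 * k \<and> \<nu> = 2 \<and> Q = mset_set {q \<in> {1..n - 1}. odd q}"
  shows "(special 2 k \<nu> (cyclic_presentation n w) \<longleftrightarrow> case_a \<or> case_b) \<and>
    (case_a \<longrightarrow> graph_iso \<Gamma> (complete_bipartite n n)) \<and>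
    (case_b \<longrightarrow> graph_iso \<Gamma>
       (disjoint_union (complete_bipartite (n div 2) (n div 2))
                       (complete_bipartite (n div 2) (n div 2))))"
proof (cases "4 \<le> k")
  case False
  \<comment> \<open>All three conditions force \<open>4 \<le> k\<close>; for \<open>special\<close>
    this is the clause for \<open>m = 2\<close>.\<close>
  then have "\<not> special 2 k \<nu> (cyclic_presentation n w)" "\<not> case_a" "\<not> case_b"
    by (simp_all add: special_def case_a_def case_b_def)
  then show ?thesis by blast
next
  case True
  interpret positive_cyclic_word n w
    using assms(1,3,6,7) True by unfold_locales simp_all
  have k: "length w = k" by fact
  have Q_eq: "Q = image_mset step (mset_set {..<k})"
    unfolding Q_def step_multiset_def k by (rule image_mset_cong) (simp add: step_def subscript_def k)
  \<comment> \<open>The class of \<open>-1\<close> modulo \<open>d\<close>: all residues for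
    \<open>d = 1\<close>, the odd ones for \<open>d = 2\<close>.\<close>
  define R where "R d = {q. q < n \<and> d dvd Suc q}" for d
  have Q: "Q = mset_set (R d) \<longleftrightarrow> inj_on step {..<k} \<and> step ` {..<k} = R d" for d
    unfolding Q_eq by (rule image_mset_eq_mset_set_iff) (simp_all add: R_def)
  have R1: "{0..n - 1} = R 1"
    using \<open>n \<ge> 1\<close> by (auto simp: R_def)
  have R2: "{q \<in> {1..n - 1}. odd q} = R 2"
    using \<open>n \<ge> 1\<close> by (auto simp: R_def Suc_le_eq intro: odd_pos)
  let ?steps = "\<lambda>d. n = d * k \<and> inj_on step {..<k} \<and> step ` {..<k} = R d"
  have "5 \<le> k" if "odd k"
    using True that by presburger
  then have a: "case_a \<longleftrightarrow> odd k \<and> \<nu> = 1 \<and> ?steps 1"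
    unfolding case_a_def R1 Q mult_1 by blast
  have b: "case_b \<longleftrightarrow> even k \<and> \<nu> = 2 \<and> ?steps 2"
    unfolding case_b_def R2 Q using True by blast
  have three: "3 \<le> k" using True by simp
  have steps_special: "special 2 k d (cyclic_presentation n w)" if d: "0 < d" "?steps d" for d
    by (rule steps_imp_special[unfolded k, OF d(1) d(2)[THEN conjunct1] three
          d(2)[THEN conjunct2, THEN conjunct1] d(2)[THEN conjunct2, THEN conjunct2, unfolded R_def] True])
  have "case_a \<or> case_b" if special: "special 2 k \<nu> (cyclic_presentation n w)"
  proof -
    obtain d where d: "d = 1 \<and> odd k \<or> d = 2 \<and> even k" "?steps d"
      unfolding R_def by (rule special_imp_steps[unfolded k, OF special assms(10,8,9,5)]) blast
    then have "special 2 k d (cyclic_presentation n w)"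
      by (intro steps_special) auto
    \<comment> \<open>The number of components of the star graph is both \<open>\<nu>\<close> and
      \<open>d\<close>.\<close>
    then have "\<nu> = d"
      using special unfolding special_def by blast
    with d show ?thesis
      unfolding a b by blast
  qed
  moreover have "special 2 k \<nu> (cyclic_presentation n w)" if "case_a \<or> case_b"
    using that steps_special[of 1] steps_special[of 2] unfolding a b by fastforce
  moreover have "graph_iso \<Gamma> (complete_bipartite n n)" if case_a
  proof -
    have st: "?steps 1" using that unfolding a by blast
    show ?thesis
      unfolding \<Gamma>_def
      by (rule graph_iso_complete_bipartite[unfolded k, OF zero_less_one st[THEN conjunct1] three
            st[THEN conjunct2, THEN conjunct1] st[THEN conjunct2, THEN conjunct2, unfolded R_def] refl])
  qed
  moreover have "graph_iso \<Gamma> (disjoint_union (complete_bipartite (n div 2) (n div 2))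
                       (complete_bipartite (n div 2) (n div 2)))" if case_b
  proof -
    have st: "?steps 2" using that unfolding b by blast
    then have half: "n div 2 = k" by simp
    show ?thesis
      unfolding \<Gamma>_def half
      by (rule graph_iso_two_complete_bipartite[unfolded k, OF zero_less_numeral st[THEN conjunct1] three
            st[THEN conjunct2, THEN conjunct1] st[THEN conjunct2, THEN conjunct2, unfolded R_def] refl])
  qed
  ultimately show ?thesis by blast
qed

end
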